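(* Let $d\ge 1$ be an integer, let $\kappa=\{\kappa_1,\dots,\kappa_d\}$ be a collection of complex numbers, let $s_0\in\mathbb{C}$ with $0<\Re(s_0)<1$, and let $J$ be a finite set of natural numbers $N\ge 1$ such that $E(d,\kappa,N,s_0)$ is non-empty for every $N\in J$. Assume further that $J$ has property $\mathbf{A}$. Then the set $$\left\{ \frac{L'(f,s_0)}{L(f,s_0)} +\frac{L'(f,1-s_0)}{L(f,1-s_0)} \;\Big|\; f\in E(d,\kappa,N,s_0),\ N \in J \right\}$$ spans a vector space over $\overline{\mathbb{Q}}$ (inside $\mathbb{C}$) of dimension at least $|J|-1$.
   Context: A finite set of integers $S$ has property $\mathbf{A}$ if for every $n\in S$ there exists a prime $p$ such that $p\mid n$ but $p\nmid m$ for any other $m\in S$. Let $f$ be a cuspidal automorphic form on $\mathrm{GL}(d)$ (over $\mathbb{Q}$) which is a Hecke eigenform with eigenvalues $\lambda_f(n)$. Its $L$-function is $L(f,s)=\sum_{n\ge 1}\lambda_f(n)n^{-s}$ for $\Re(s)>1$, extended by meromorphic continuation. The completed $L$-function is $$\Lambda(f,s)=N^{s/2}\pi^{-ds/2}\prod_{j=1}^{d}\Gamma\left(\frac{s+\kappa_j}{2}\right)L(f,s),$$ where the integer $N\ge1$ is the conductor and the complex numbers $\kappa_j$ are the local parameters of $f$ at infinity, with $\Re(\kappa_j)>-1$. It continues meromorphically to $\mathbb{C}$ with at most poles at $s=0,1$ and satisfies $\Lambda(f,s)=\epsilon(f)\Lambda(\overline f,1-s)$, where $\overline f$ is the dual of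 $f$ and $|\epsilon(f)|=1$. The form $f$ is self-dual if $\overline f=f$. $E(d,\kappa,N,s_0)$ denotes the set of all cuspidal, self-dual automorphic Hecke eigenforms $f$ of degree $d$ and conductor $N$ whose local parameters at infinity are $\kappa=\{\kappa_1,\dots,\kappa_d\}$ and for which $L(f,s_0)\ne 0$; it is defined for $\Re(s_0)\in(0,1)$. It is understood that $s_0$ is such that the displayed quantities are defined, i.e. $L(f,1-s_0)\neq 0$ for the forms $f$ considered. *)

theory Defs
  imports "HOL-Complex_Analysis.Complex_Analysis"
begin

unbundle no fps_syntax

section \<open>Property A\<close>

definition property_A :: "int set \<Rightarrow> bool" where
  "property_A S \<longleftrightarrow> finite S \<and>
     (\<forall>n\<in>S. \<exists>p. prime p \<and> p dvd n \<and> (\<forall>m\<in>S. m \<noteq> n \<longrightarrow> \<not> p dvd m))"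


section \<open>The complex numbers as a vector space over the algebraic numbers\<close>

interpretation rat_complex: vector_space "\<lambda>(r::rat) (z::complex). of_rat r * z"
  by unfold_locales (simp_all add: algebra_simps of_rat_add of_rat_mult)

lemma algebraic_if_powers_in_span:
  assumes fin: "finite S" and pow: "\<And>i::nat. z ^ i \<in> rat_complex.span S"
  shows "algebraic (z::complex)"
proof -
  define K where "K = {..card S}"
  show ?thesis
  proof (cases "inj_on (\<lambda>i. z ^ i) K")
    case False
    then obtain i j where ij: "i \<noteq> j" "z ^ i = z ^ j"
      by (auto simp: inj_on_def)
    let ?p = "monom 1 i - monom 1 j :: complex poly"
    have "coeff ?p i \<noteq> 0" using ij by simp
    hence "?p \<noteq> 0" by (metis coeff_0)
    moreover have "\<forall>k. coeff ?p k \<in> \<int>" by auto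
    moreover have "poly ?p z = 0" using ij by (simp add: poly_monom)
    ultimately show ?thesis by (intro algebraicI[of ?p]) auto
  next
    case True
    have "rat_complex.dependent ((\<lambda>i. z ^ i) ` K)"
    proof (rule ccontr)
      assume "\<not> ?thesis"
      then have "card ((\<lambda>i. z ^ i) ` K) \<le> card S"
        using rat_complex.independent_span_bound[OF fin, of "(\<lambda>i. z ^ i) ` K"] pow by auto
      thus False using True by (simp add: card_image K_def)
    qed
    then obtain u where u: "\<exists>v\<in>(\<lambda>i. z ^ i) ` K. u v \<noteq> 0"
        "(\<Sum>v\<in>(\<lambda>i. z ^ i) ` K. of_rat (u v) * v) = 0"
      by (subst (asm) rat_complex.dependent_finite) (auto simp: K_def)
    define p where "p = (\<Sum>i\<in>K. monom (of_rat (u (z ^ i))) i :: complex poly)"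
    have coeff: "coeff p k = (if k \<in> K then of_rat (u (z ^ k)) else 0)" for k
      by (simp add: p_def coeff_sum K_def)
    have "p \<noteq> 0" using u(1) coeff by (metis coeff_0 image_iff of_rat_eq_0_iff)
    moreover have "coeff p k \<in> \<rat>" for k by (simp add: coeff)
    moreover have "poly p z = 0"
      using u(2) True by (simp add: p_def poly_sum poly_monom sum.reindex)
    ultimately show ?thesis by (intro algebraicI'[of p]) auto
  qed
qed

lemma algebraic_imp_power_in_span:
  assumes "algebraic (x::complex)"
  obtains n where "n > 0" "x ^ n \<in> rat_complex.span ((\<lambda>i. x ^ i) ` {..<n})"
proof -
  from assms obtain p where p: "\<And>i. coeff p i \<in> \<rat>" "p \<noteq> 0" "poly p x = 0"
    unfolding algebraic_altdef by blast
  define n where "n = degree p"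
  have deg: "n > 0"
  proof (rule ccontr)
    assume "\<not> n > 0"
    then obtain c where "p = [:c:]" unfolding n_def by (auto elim: degree_eq_zeroE)
    then show False using p(2,3) by simp
  qed
  have "\<exists>q. coeff p i = of_rat q" for i using p(1)[of i] by (auto elim: Rats_cases)
  then obtain q where q: "\<And>i. coeff p i = of_rat (q i)" by metis
  have qn: "q n \<noteq> 0" using p(2) q[of n] by (auto simp: n_def)
  have "0 = (\<Sum>i\<le>n. of_rat (q i) * x ^ i)" using p(3) q by (simp add: poly_altdef n_def)
  also have "\<dots> = (\<Sum>i<n. of_rat (q i) * x ^ i) + of_rat (q n) * x ^ n"
    by (simp add: lessThan_Suc_atMost[symmetric])
  finally have eq: "of_rat (q n) * x ^ n = - (\<Sum>i<n. of_rat (q i) * x ^ i)"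
    by (simp add: eq_neg_iff_add_eq_0 add.commute)
  have "x ^ n = inverse (of_rat (q n)) * (of_rat (q n) * x ^ n)" using qn by simp
  also have "\<dots> = of_rat (- inverse (q n)) * (\<Sum>i<n. of_rat (q i) * x ^ i)"
    unfolding eq by (simp add: of_rat_minus of_rat_inverse)
  finally have "x ^ n = of_rat (- inverse (q n)) * (\<Sum>i<n. of_rat (q i) * x ^ i)" .
  moreover have "\<dots> \<in> rat_complex.span ((\<lambda>i. x ^ i) ` {..<n})"
    by (intro rat_complex.span_scale rat_complex.span_sum rat_complex.span_base) auto
  ultimately show ?thesis using that deg by metis
qed

lemma algebraic_add_mult:
  assumes "algebraic (x::complex)" "algebraic y"
  shows "algebraic (x + y)" "algebraic (x * y)"
proof -
  obtain m where m: "m > 0" "x ^ m \<in> rat_complex.span ((\<lambda>i. x ^ i) ` {..<m})"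
    using algebraic_imp_power_in_span[OF assms(1)] by blast
  obtain n where n: "n > 0" "y ^ n \<in> rat_complex.span ((\<lambda>i. y ^ i) ` {..<n})"
    using algebraic_imp_power_in_span[OF assms(2)] by blast
  define S where "S = (\<lambda>(i,j). x ^ i * y ^ j) ` ({..<m} \<times> {..<n})"
  let ?V = "rat_complex.span S"
  have fin: "finite S" by (simp add: S_def)
  have span_mult: "c * v \<in> ?V" if "v \<in> rat_complex.span T" "\<And>t. t \<in> T \<Longrightarrow> c * t \<in> ?V" for c v T
    using that(1)
  proof (induction rule: rat_complex.span_induct_alt)
    case base
    then show ?case by (simp add: rat_complex.span_zero)
  next
    case (step r t w)
    have "of_rat r * (c * t) + c * w \<in> ?V"
      using step that(2) by (intro rat_complex.span_add rat_complex.span_scale) auto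
    then show ?case by (simp add: algebra_simps)
  qed
  have base: "x ^ i * y ^ j \<in> ?V" if "i < m" "j < n" for i j
    using that by (intro rat_complex.span_base) (auto simp: S_def)
  have xV: "x * v \<in> ?V" if "v \<in> ?V" for v
  proof (rule span_mult[OF that])
    fix t assume "t \<in> S"
    then obtain i j where ij: "i < m" "j < n" "t = x ^ i * y ^ j" by (auto simp: S_def)
    show "x * t \<in> ?V"
    proof (cases "Suc i < m")
      case True
      then show ?thesis using base[of "Suc i" j] ij by (simp add: mult.assoc)
    next
      case False
      then have "Suc i = m" using ij by simp
      moreover have "y ^ j * x ^ m \<in> ?V"
        by (rule span_mult[OF m(2)]) (use base ij in \<open>auto simp: mult.commute\<close>)
      ultimately show ?thesis using ij by (metis mult.assoc mult.commute power_Suc)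
    qed
  qed
  have yV: "y * v \<in> ?V" if "v \<in> ?V" for v
  proof (rule span_mult[OF that])
    fix t assume "t \<in> S"
    then obtain i j where ij: "i < m" "j < n" "t = x ^ i * y ^ j" by (auto simp: S_def)
    show "y * t \<in> ?V"
    proof (cases "Suc j < n")
      case True
      then show ?thesis using base[of i "Suc j"] ij by (simp add: mult.left_commute)
    next
      case False
      then have "Suc j = n" using ij by simp
      moreover have "x ^ i * y ^ n \<in> ?V"
        by (rule span_mult[OF n(2)]) (use base ij in auto)
      ultimately show ?thesis using ij by (metis mult.left_commute power_Suc)
    qed
  qed
  have one: "1 \<in> ?V" using base[of 0 0] m n by simp
  have "(x + y) ^ k \<in> ?V" for k
  proof (induction k)
    case (Suc k)
    then show ?case using xV yV by (simp add: distrib_right rat_complex.span_add)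
  qed (use one in simp)
  then show "algebraic (x + y)" using algebraic_if_powers_in_span[OF fin] by blast
  have "(x * y) ^ k \<in> ?V" for k
  proof (induction k)
    case (Suc k)
    then show ?case using xV yV by (simp add: mult.assoc)
  qed (use one in simp)
  then show "algebraic (x * y)" using algebraic_if_powers_in_span[OF fin] by blast
qed

lemma algebraic_diff: "algebraic (x::complex) \<Longrightarrow> algebraic y \<Longrightarrow> algebraic (x - y)"
  using algebraic_add_mult(1)[of x "- y"] by auto

typedef qbar = "{z::complex. algebraic z}"
  morphisms complex_of_qbar Abs_qbar
  by (rule exI[of _ 0]) simp

instantiation qbar :: field
begin

definition "0 = Abs_qbar 0"
definition "1 = Abs_qbar 1"
definition "x + y = Abs_qbar (complex_of_qbar x + complex_of_qbar y)"
definition "x * y = Abs_qbar (complex_of_qbar x * complex_of_qbar y)"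
definition "- x = Abs_qbar (- complex_of_qbar x)"
definition "x - y = x + (- y :: qbar)"
definition "inverse x = Abs_qbar (inverse (complex_of_qbar x))"
definition "x div y = x * (inverse y :: qbar)"

lemma algebraic_complex_of_qbar: "algebraic (complex_of_qbar x)"
  using complex_of_qbar[of x] by simp

lemma complex_of_qbar_simps:
  fixes x y :: qbar
  shows
  "complex_of_qbar 0 = 0"
  "complex_of_qbar 1 = 1"
  "complex_of_qbar (x + y) = complex_of_qbar x + complex_of_qbar y"
  "complex_of_qbar (x * y) = complex_of_qbar x * complex_of_qbar y"
  "complex_of_qbar (- x) = - complex_of_qbar x"
  "complex_of_qbar (x - y) = complex_of_qbar x - complex_of_qbar y"
  "complex_of_qbar (inverse x) = inverse (complex_of_qbar x)"
  "complex_of_qbar (x div y) = complex_of_qbar x / complex_of_qbar y"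
  by (simp_all add: zero_qbar_def one_qbar_def plus_qbar_def times_qbar_def uminus_qbar_def
      minus_qbar_def inverse_qbar_def divide_qbar_def Abs_qbar_inverse algebraic_complex_of_qbar
      algebraic_add_mult algebraic_diff algebraic_inverse rat_imp_algebraic divide_inverse)

instance
  by standard
     (simp_all add: complex_of_qbar_inject[symmetric] complex_of_qbar_simps field_simps)

end

text \<open>The dimension of a set is that of its span; it is 0 if the span is infinite-dimensional.\<close>

global_interpretation qbar_complex: vector_space "\<lambda>(a::qbar) (z::complex). complex_of_qbar a * z"
  defines qbar_dim = qbar_complex.dim
  by unfold_locales (simp_all add: algebra_simps complex_of_qbar_simps)


section \<open>Functions on the general linear group over the reals\<close>

text \<open>
  The degree is \<open>d = CARD('n)\<close>; the linear order on the index type is only used to speak of the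
  last row of a matrix.
\<close>

type_synonym ('a, 'n) sq_matrix = "(('a, 'n) vec, 'n) vec"
type_synonym 'n real_matrix = "(real, 'n) sq_matrix"

definition GL :: "'n::finite real_matrix set" where
  "GL = {g. invertible g}"

definition dir_deriv :: "'n::finite real_matrix \<Rightarrow> ('n real_matrix \<Rightarrow> complex) \<Rightarrow> 'n real_matrix \<Rightarrow> complex" where
  "dir_deriv Z \<phi> g = vector_derivative (\<lambda>t. \<phi> (g + t *\<^sub>R Z)) (at 0)"

primrec C_k_on_GL :: "nat \<Rightarrow> ('n::finite real_matrix \<Rightarrow> complex) \<Rightarrow> bool" where
  "C_k_on_GL 0 \<phi> \<longleftrightarrow> continuous_on GL \<phi>"
| "C_k_on_GL (Suc k) \<phi> \<longleftrightarrow> continuous_on GL \<phi> \<and>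
     (\<forall>Z. (\<forall>g\<in>GL. (\<lambda>t. \<phi> (g + t *\<^sub>R Z)) differentiable (at (0::real))) \<and>
          C_k_on_GL k (dir_deriv Z \<phi>))"

definition smooth_on_GL :: "('n::finite real_matrix \<Rightarrow> complex) \<Rightarrow> bool" where
  "smooth_on_GL \<phi> \<longleftrightarrow> (\<forall>k. C_k_on_GL k \<phi>)"

text \<open>
  The left-invariant derivation attached to \<open>X\<close> in the Lie algebra of all matrices: the velocity
  at \<open>t = 0\<close> of \<open>g exp(tX)\<close> is \<open>g X\<close>.
\<close>

definition lie_deriv :: "'n::finite real_matrix \<Rightarrow> ('n real_matrix \<Rightarrow> complex) \<Rightarrow> 'n real_matrix \<Rightarrow> complex" where
  "lie_deriv X \<phi> g = dir_deriv (g ** X) \<phi> g"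

text \<open>
  The complexified universal enveloping algebra, realised as the algebra of left-invariant
  differential operators, and its centre.
\<close>

inductive_set enveloping_algebra ::
    "(('n::finite real_matrix \<Rightarrow> complex) \<Rightarrow> ('n real_matrix \<Rightarrow> complex)) set" where
  "(\<lambda>\<phi>. \<phi>) \<in> enveloping_algebra"
| "D \<in> enveloping_algebra \<Longrightarrow> (\<lambda>\<phi>. lie_deriv X (D \<phi>)) \<in> enveloping_algebra"
| "D \<in> enveloping_algebra \<Longrightarrow> D' \<in> enveloping_algebra \<Longrightarrow>
     (\<lambda>\<phi> g. D \<phi> g + D' \<phi> g) \<in> enveloping_algebra"
| "D \<in> enveloping_algebra \<Longrightarrow> (\<lambda>\<phi> g. c * D \<phi> g) \<in> enveloping_algebra"

definition enveloping_centre ::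
    "(('n::finite real_matrix \<Rightarrow> complex) \<Rightarrow> ('n real_matrix \<Rightarrow> complex)) set" where
  "enveloping_centre = {D \<in> enveloping_algebra.
     \<forall>X \<phi>. smooth_on_GL \<phi> \<longrightarrow> (\<forall>g\<in>GL. D (lie_deriv X \<phi>) g = lie_deriv X (D \<phi>) g)}"

definition finite_dimensional_on_GL :: "('n::finite real_matrix \<Rightarrow> complex) set \<Rightarrow> bool" where
  "finite_dimensional_on_GL A \<longleftrightarrow>
     (\<exists>B. finite B \<and> (\<forall>\<phi>\<in>A. \<exists>c. \<forall>g\<in>GL. \<phi> g = (\<Sum>\<beta>\<in>B. c \<beta> * \<beta> g)))"

definition K_finite :: "('n::finite real_matrix \<Rightarrow> complex) \<Rightarrow> bool" where
  "K_finite \<phi> \<longleftrightarrow> finite_dimensional_on_GL {\<lambda>g. \<phi> (g ** k) | k. orthogonal_matrix k}"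

definition Z_finite :: "('n::finite real_matrix \<Rightarrow> complex) \<Rightarrow> bool" where
  "Z_finite \<phi> \<longleftrightarrow> finite_dimensional_on_GL {D \<phi> | D. D \<in> enveloping_centre}"

definition moderate_growth :: "('n::finite real_matrix \<Rightarrow> complex) \<Rightarrow> bool" where
  "moderate_growth \<phi> \<longleftrightarrow>
     (\<exists>C r. \<forall>g\<in>GL. norm (\<phi> g) \<le> C * (norm g + norm (matrix_inv g)) ^ r)"


section \<open>Cuspidal automorphic forms\<close>

definition dirichlet_character :: "nat \<Rightarrow> (int \<Rightarrow> complex) \<Rightarrow> bool" where
  "dirichlet_character N \<psi> \<longleftrightarrow>
     (\<forall>a b. \<psi> (a * b) = \<psi> a * \<psi> b) \<and>
     (\<forall>a. \<psi> (a + int N) = \<psi> a) \<and>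
     (\<forall>a. \<psi> a \<noteq> 0 \<longleftrightarrow> coprime a (int N))"

definition last_index :: "'n::{finite,linorder}" where
  "last_index = Max UNIV"

definition real_mat :: "(int, 'n::finite) sq_matrix \<Rightarrow> 'n real_matrix" where
  "real_mat A = (\<chi> i j. real_of_int (A $ i $ j))"

text \<open>
  Integral matrices of determinant \<open>\<plusminus>n\<close> whose last row is congruent to \<open>(0, \<dots>, 0, u)\<close>
  modulo \<open>N\<close> with \<open>u\<close> a unit modulo \<open>N\<close>; for \<open>n = 1\<close> this is the congruence group
  \<open>\<Gamma>\<^sub>0(N)\<close> in \<open>GL\<^sub>d(\<int>)\<close>.
\<close>

definition Hecke_matrices :: "nat \<Rightarrow> nat \<Rightarrow> (int, 'n::{finite,linorder}) sq_matrix set" where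
  "Hecke_matrices N n = {A.
     \<bar>det A\<bar> = int n \<and>
     (\<forall>j. j \<noteq> last_index \<longrightarrow> int N dvd A $ last_index $ j) \<and>
     coprime (A $ last_index $ last_index) (int N)}"

definition Gamma0 :: "nat \<Rightarrow> (int, 'n::{finite,linorder}) sq_matrix set" where
  "Gamma0 N = Hecke_matrices N 1"

text \<open>
  Let \<open>K\<^sub>0(N)\<close> be the subgroup of \<open>GL\<^sub>d\<close> of the profinite integers defined by the same condition
  modulo \<open>N\<close> on the last row, so that \<open>\<Gamma>\<^sub>0(N) = GL\<^sub>d(\<rat>) \<inter> K\<^sub>0(N)\<close>. By strong
  approximation \<open>GL\<^sub>d(\<A>) = GL\<^sub>d(\<rat>) GL\<^sub>d(\<real>) K\<^sub>0(N)\<close>, so an adelic automorphic form on which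
  \<open>K\<^sub>0(N)\<close> acts through a character of the lower right entry is determined by its restriction
  \<open>\<phi>\<close> to \<open>GL\<^sub>d(\<real>)\<close> together with that character. We record the level \<open>N\<close>, the Dirichlet
  character of the form (its nebentypus), and \<open>\<phi>\<close>, extended by zero to singular matrices. For
  \<open>d = 1\<close> the form belonging to a Dirichlet character \<open>\<psi>\<close> is a function on the nonzero reals
  with the parity of \<open>\<psi>\<close>.
\<close>

datatype 'n aut_form =
  Aut_Form (level: nat) (nebentypus: "int \<Rightarrow> complex") (form_fun: "'n real_matrix \<Rightarrow> complex")

definition automorphic_form :: "'n::{finite,linorder} aut_form \<Rightarrow> bool" where
  "automorphic_form f \<longleftrightarrow>
     level f \<ge> 1 \<and> dirichlet_character (level f) (nebentypus f) \<and>
     (\<forall>g. g \<notin> GL \<longrightarrow> form_fun f g = 0) \<and>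
     (\<forall>\<gamma>\<in>Gamma0 (level f). \<forall>g\<in>GL.
        form_fun f (real_mat \<gamma> ** g) =
          nebentypus f (\<gamma> $ last_index $ last_index) * form_fun f g) \<and>
     (\<exists>y::real. \<forall>t>0. \<forall>g\<in>GL. form_fun f (t *\<^sub>R g) = cis (y * ln t) * form_fun f g) \<and>
     smooth_on_GL (form_fun f) \<and> K_finite (form_fun f) \<and> Z_finite (form_fun f) \<and>
     moderate_growth (form_fun f)"

text \<open>
  Constant terms along all rational parabolic subgroups vanish. For a proper nonempty set \<open>I\<close> of
  indices, the matrices \<open>1 + X\<close> with \<open>X\<close> supported on rows in \<open>I\<close> and columns outside
  \<open>I\<close> form the unipotent radical of a maximal parabolic subgroup; every maximal rational
  parabolic subgroup is conjugate to one of these by some \<open>\<gamma>\<close> in \<open>GL\<^sub>d(\<int>)\<close>. The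
  integrand has period \<open>N\<close> in each entry of \<open>X\<close>. Integrating over the whole box, and not only
  over the entries which occur, multiplies the constant term by a power of \<open>N\<close>.
\<close>

definition unipotent :: "'n::finite set \<Rightarrow> 'n real_matrix \<Rightarrow> 'n real_matrix" where
  "unipotent I X = mat 1 + (\<chi> i j. if i \<in> I \<and> j \<notin> I then X $ i $ j else 0)"

definition cuspidal :: "'n::{finite,linorder} aut_form \<Rightarrow> bool" where
  "cuspidal f \<longleftrightarrow>
     (\<forall>I. I \<noteq> {} \<and> I \<noteq> UNIV \<longrightarrow>
       (\<forall>\<gamma>. \<bar>det \<gamma>\<bar> = 1 \<longrightarrow> (\<forall>g\<in>GL.
          integral (cbox 0 (\<chi> i j. real (level f)))
            (\<lambda>X. form_fun f (real_mat \<gamma> ** unipotent I X ** g)) = 0)))"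


section \<open>Hecke operators and the conductor\<close>

text \<open>
  The adelic operator of right convolution with the characteristic function of all integral
  matrices of determinant \<open>n\<close> (times units) in the level semigroup, read off on \<open>GL\<^sub>d(\<real>)\<close>:
  left multiplication of the adelic argument by \<open>A\<inverse>\<close> turns the finite component \<open>A\<close> into
  the archimedean component \<open>A\<inverse>\<close>. The summand depends only on the coset \<open>A \<Gamma>\<^sub>0(N)\<close>.
  The normalisation makes the eigenvalue the \<open>n\<close>-th Dirichlet coefficient of the standard
  \<open>L\<close>-function: at an unramified prime with Satake parameters \<open>\<alpha>\<^sub>1, \<dots>, \<alpha>\<^sub>d\<close> the eigenvalue
  for \<open>n = p\<^sup>k\<close> is the complete homogeneous symmetric polynomial of degree \<open>k\<close> in the \<open>\<alpha>\<^sub>j\<close>;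
  for \<open>d = 1\<close> it is \<open>\<psi>(n)\<close>; for \<open>d = 2\<close> one finds the classical \<open>T\<^sub>n\<close> and \<open>U\<^sub>p\<close>.
\<close>

definition Hecke_cosets :: "nat \<Rightarrow> nat \<Rightarrow> (int, 'n::{finite,linorder}) sq_matrix set set" where
  "Hecke_cosets N n = (\<lambda>A. (\<lambda>\<gamma>. A ** \<gamma>) ` Gamma0 N) ` Hecke_matrices N n"

definition Hecke_operator :: "nat \<Rightarrow> 'n::{finite,linorder} aut_form \<Rightarrow> 'n real_matrix \<Rightarrow> complex" where
  "Hecke_operator n f g =
     of_real (real n powr (- (real CARD('n) - 1) / 2)) *
     (\<Sum>C\<in>Hecke_cosets (level f) n.
        let A = (SOME A. A \<in> C)
        in nebentypus f (A $ last_index $ last_index) *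
           form_fun f (matrix_inv (real_mat A) ** g))"

definition Hecke_eigenform :: "'n::{finite,linorder} aut_form \<Rightarrow> bool" where
  "Hecke_eigenform f \<longleftrightarrow>
     (\<exists>g\<in>GL. form_fun f g \<noteq> 0) \<and>
     (\<forall>n\<ge>1. \<exists>c. \<forall>g\<in>GL. Hecke_operator n f g = c * form_fun f g)"

definition Hecke_eigenvalue :: "'n::{finite,linorder} aut_form \<Rightarrow> nat \<Rightarrow> complex" where
  "Hecke_eigenvalue f n = (THE c. \<forall>g\<in>GL. Hecke_operator n f g = c * form_fun f g)"

definition cuspidal_eigenform :: "'n::{finite,linorder} aut_form \<Rightarrow> bool" where
  "cuspidal_eigenform f \<longleftrightarrow> automorphic_form f \<and> cuspidal f \<and> Hecke_eigenform f"

text \<open>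
  The conductor is the smallest level at which the automorphic representation generated by \<open>f\<close>
  has a form; by strong multiplicity one, the representation is determined by the Hecke eigenvalues
  away from the levels. A form whose level equals its conductor is a newform, and only then are
  its Hecke eigenvalues at the primes dividing the level the coefficients of the \<open>L\<close>-function
  of the representation.
\<close>

definition conductor :: "'n::{finite,linorder} aut_form \<Rightarrow> nat" where
  "conductor f = (LEAST M. \<exists>h :: 'n aut_form. cuspidal_eigenform h \<and> level h = M \<and>
     (\<forall>n\<ge>1. coprime n (level f * level h) \<longrightarrow> Hecke_eigenvalue h n = Hecke_eigenvalue f n))"

text \<open>
  Complex conjugation realises the contragredient, as the central character is unitary.
  A form is determined by its Hecke eigenvalues only up to the choice of a vector in the
  archimedean component, so \<open>f\<close> and its dual are compared through their Hecke eigenvalues.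
\<close>

definition dual_form :: "'n::finite aut_form \<Rightarrow> 'n aut_form" where
  "dual_form f = Aut_Form (level f) (\<lambda>a. cnj (nebentypus f a)) (\<lambda>g. cnj (form_fun f g))"

definition self_dual :: "'n::{finite,linorder} aut_form \<Rightarrow> bool" where
  "self_dual f \<longleftrightarrow> (\<forall>n\<ge>1. Hecke_eigenvalue (dual_form f) n = Hecke_eigenvalue f n)"


section \<open>Local parameters at infinity\<close>

definition Gamma_R :: "complex \<Rightarrow> complex" where
  "Gamma_R s = of_real pi powr (- s / 2) * Gamma (s / 2)"

text \<open>
  Godement--Jacquet theory: the archimedean \<open>L\<close>-factor is the greatest common divisor of the
  zeta integrals \<open>\<integral> \<Phi>(g) c(g) |det g|\<^bsup>s + (d - 1)/2\<^esup> dg\<close>, where \<open>\<Phi>\<close> is a polynomial times the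
  standard Gaussian and \<open>c\<close> is a matrix coefficient. The vectors used are those of the
  \<open>(\<gg>, K)\<close>-module generated by \<open>f\<close>, the functionals are the evaluations at points
  \<open>x\<close>, and \<open>dg = |det g|\<^bsup>-d\<^esup> dX\<close>. The \<open>\<kappa>\<^sub>j\<close> are the parameters for which this
  factor is the product of the \<open>\<Gamma>\<^sub>\<real>(s + \<kappa>\<^sub>j)\<close>.
\<close>

definition archimedean_vectors :: "'n::finite aut_form \<Rightarrow> ('n real_matrix \<Rightarrow> complex) set" where
  "archimedean_vectors f =
     {\<lambda>g. D (form_fun f) (g ** k) | D k. D \<in> enveloping_algebra \<and> orthogonal_matrix k}"

definition zeta_integrand ::
    "('n::finite real_matrix \<Rightarrow> real) \<Rightarrow> ('n real_matrix \<Rightarrow> complex) \<Rightarrow> 'n real_matrix \<Rightarrow> complex \<Rightarrow> 'n real_matrix \<Rightarrow> complex"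
where
  "zeta_integrand P v x s X =
     of_real (P X * exp (- pi * (norm X)\<^sup>2)) * v (x ** X) *
     of_real \<bar>det X\<bar> powr (s - (of_nat CARD('n) + 1) / 2)"

definition zeta_quotient ::
    "complex multiset \<Rightarrow> ('n::finite real_matrix \<Rightarrow> real) \<Rightarrow> ('n real_matrix \<Rightarrow> complex) \<Rightarrow> 'n real_matrix \<Rightarrow>
     (complex \<Rightarrow> complex) \<Rightarrow> bool"
where
  "zeta_quotient \<kappa> P v x H \<longleftrightarrow>
     H holomorphic_on UNIV \<and>
     (\<exists>\<sigma>. \<forall>s. Re s > \<sigma> \<longrightarrow>
        integrable lborel (zeta_integrand P v x s) \<and>
        integral\<^sup>L lborel (zeta_integrand P v x s) = H s * (\<Prod>k\<in>#\<kappa>. Gamma_R (s + k)))"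

definition local_parameters_at_infinity ::
    "'n::{finite,linorder} aut_form \<Rightarrow> complex multiset \<Rightarrow> bool"
where
  "local_parameters_at_infinity f \<kappa> \<longleftrightarrow>
     size \<kappa> = CARD('n) \<and>
     (\<forall>P v x. real_polynomial_function P \<and> v \<in> archimedean_vectors f \<and> x \<in> GL \<longrightarrow>
        (\<exists>H. zeta_quotient \<kappa> P v x H)) \<and>
     (\<forall>s. \<exists>P v x H. real_polynomial_function P \<and> v \<in> archimedean_vectors f \<and> x \<in> GL \<and>
        zeta_quotient \<kappa> P v x H \<and> H s \<noteq> 0)"


section \<open>L-functions\<close>

definition is_L_function :: "'n::{finite,linorder} aut_form \<Rightarrow> (complex \<Rightarrow> complex) \<Rightarrow> bool" where
  "is_L_function f L \<longleftrightarrow>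
     L nicely_meromorphic_on UNIV \<and>
     (\<forall>s. Re s > 1 \<longrightarrow>
        (\<lambda>n. Hecke_eigenvalue f (Suc n) * of_nat (Suc n) powr (- s)) sums L s)"

definition L_function :: "'n::{finite,linorder} aut_form \<Rightarrow> complex \<Rightarrow> complex" where
  "L_function f = (THE L. is_L_function f L)"

text \<open>
  In HOL the Gamma function takes the value 0 at its poles; \<^const>\<open>remove_sings\<close>
  restores the values of the meromorphic product there.
\<close>

definition completed_L_function ::
    "complex multiset \<Rightarrow> 'n::{finite,linorder} aut_form \<Rightarrow> complex \<Rightarrow> complex"
where
  "completed_L_function \<kappa> f = remove_sings (\<lambda>s.
     of_nat (conductor f) powr (s / 2) * of_real pi powr (- of_nat CARD('n) * s / 2) *
     (\<Prod>k\<in>#\<kappa>. Gamma ((s + k) / 2)) * L_function f s)"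

text \<open>
  The standard analytic facts for a form with parameters \<open>\<kappa>\<close> at infinity. They are theorems
  of Godement and Jacquet, which are not available here, so they are stated as a property and are
  not part of the definition of the forms. The parameters of the dual form are the complex
  conjugates.
\<close>

definition standard_functional_equation ::
    "complex multiset \<Rightarrow> 'n::{finite,linorder} aut_form \<Rightarrow> bool"
where
  "standard_functional_equation \<kappa> f \<longleftrightarrow>
     (\<forall>k\<in>#\<kappa>. Re k > -1) \<and>
     (\<exists>L. is_L_function f L) \<and>
     completed_L_function \<kappa> f holomorphic_on - {0, 1} \<and>
     completed_L_function \<kappa> f nicely_meromorphic_on UNIV \<and>
     (\<exists>\<epsilon>. norm \<epsilon> = 1 \<and>
        (\<forall>s. completed_L_function \<kappa> f s =
               \<epsilon> * completed_L_function (image_mset cnj \<kappa>) (dual_form f) (1 - s)))"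

definition E_set ::
    "complex multiset \<Rightarrow> nat \<Rightarrow> complex \<Rightarrow> 'n::{finite,linorder} aut_form set"
where
  "E_set \<kappa> N s\<^sub>0 = {f. cuspidal_eigenform f \<and> self_dual f \<and>
     level f = N \<and> conductor f = N \<and>
     local_parameters_at_infinity f \<kappa> \<and> L_function f s\<^sub>0 \<noteq> 0}"

end

theory Submission
  imports Defs "HOL-Real_Asymp.Real_Asymp"
begin

text \<open>
  Taking logarithmic derivatives in the functional equation shows that, for a self-dual form of
  conductor \<open>N\<close>, the quantity \<open>L'/L(s\<^sub>0) + L'/L(1 - s\<^sub>0)\<close> equals \<open>c - ln N\<close>, where \<open>c\<close> only
  depends on \<open>\<kappa>\<close>, the degree and \<open>s\<^sub>0\<close>. Property A makes the conductors multiplicatively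
  independent, so by Baker's theorem their logarithms are linearly independent over the algebraic
  numbers; as these logarithms lie in the span of \<open>c\<close> and the numbers \<open>c - ln N\<close>, the latter span
  a space of dimension at least \<open>|J| - 1\<close>.

  Baker's theorem is only needed for logarithms of positive integers. A relation expressing one
  logarithm through the others makes the functions \<open>exp(z \<Sum> e\<^sub>a ln a)\<close> exponentials in fewer
  directional frequencies \<open>\<gamma>\<^sub>a\<close>. Siegel's lemma gives integers \<open>p(e)\<close> such that the sums
  \<open>F\<^sub>\<mu>(z) = \<Sum> p(e) \<gamma>\<^bsup>\<mu>\<^esup> exp(z \<Sum> e\<^sub>a ln a)\<close> vanish at \<open>0, \<dots>, q - 1\<close> for all \<open>|\<mu>| < T\<close>. As
  derivatives of \<open>F\<^sub>\<mu>\<close> are combinations of such sums, these are zeros of high order, and the maximum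
  principle together with Liouville's inequality gives vanishing at \<open>q\<close> times as many integers for
  slightly fewer \<open>\<mu>\<close>. After enough steps \<open>F\<^sub>0\<close> vanishes at more integers than it has terms.
\<close>

section \<open>Siegel's lemma and Liouville's inequality\<close>

lemma siegel:
  fixes a :: "'e \<Rightarrow> 'x \<Rightarrow> int" and A :: nat
  assumes E: "finite E" and X: "finite X" "X \<noteq> {}" and cards: "2 * card E \<le> card X"
    and A: "A \<ge> 1" and bound: "\<And>e x. e \<in> E \<Longrightarrow> x \<in> X \<Longrightarrow> \<bar>a e x\<bar> \<le> int A"
  shows "\<exists>p. (\<forall>e\<in>E. (\<Sum>x\<in>X. a e x * p x) = 0) \<and> (\<forall>x\<in>X. \<bar>p x\<bar> \<le> int (2 * card X * A)) \<and>
    (\<exists>x\<in>X. p x \<noteq> 0)"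
proof (cases "E = {}")
  case True
  obtain x where "x \<in> X" using X by blast
  have "0 < 2 * card X * A" using X A by (simp add: card_gt_0_iff)
  then have "1 \<le> int (2 * card X * A)" by linarith
  then show ?thesis
    using True \<open>x \<in> X\<close> by (intro exI[of _ "\<lambda>_. 1"]) auto
next
  case False
  define B where "B = 2 * card X * A"
  define V where "V = (PiE X (\<lambda>_. {0..int B}))"
  define W where "W = (PiE E (\<lambda>_. {-int (card X * A * B)..int (card X * A * B)}))"
  define \<Phi> where "\<Phi> = (\<lambda>p. \<lambda>e\<in>E. \<Sum>x\<in>X. a e x * p x)"
  have cX: "card X > 0" and cE: "card E > 0"
    using X E False by (auto simp: card_gt_0_iff)
  have maps: "\<Phi> ` V \<subseteq> W"
  proof (clarsimp simp: \<Phi>_def W_def PiE_iff V_def)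
    fix p e assume p: "\<forall>i\<in>X. 0 \<le> p i \<and> p i \<le> int B" "e \<in> E"
    have "\<bar>\<Sum>x\<in>X. a e x * p x\<bar> \<le> (\<Sum>x\<in>X. \<bar>a e x * p x\<bar>)" by (rule sum_abs)
    also have "\<dots> \<le> (\<Sum>x\<in>X. int A * int B)"
      using p bound by (intro sum_mono) (auto simp: abs_mult intro!: mult_mono)
    also have "\<dots> = int (card X) * int A * int B" by simp
    finally show "- (int (card X) * int A * int B) \<le> (\<Sum>x\<in>X. a e x * p x) \<and>
       (\<Sum>x\<in>X. a e x * p x) \<le> int (card X) * int A * int B" by linarith
  qed
  have cardV: "card V = (B + 1) ^ card X"
    using X by (simp add: V_def card_PiE nat_add_distrib)
  have cardW: "card W = (2 * (card X * A * B) + 1) ^ card E"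
    using E by (simp add: W_def card_PiE nat_add_distrib nat_mult_distrib mult_ac)
  have "2 * (card X * A * B) + 1 = B * B + 1" by (simp add: B_def)
  also have "\<dots> < (B + 1) ^ 2"
    using cX A by (simp add: B_def power2_eq_square)
  finally have "card W < ((B + 1) ^ 2) ^ card E"
    unfolding cardW using cE by (intro power_strict_mono) auto
  also have "\<dots> = (B + 1) ^ (2 * card E)" by (simp add: power_mult)
  also have "\<dots> \<le> card V"
    unfolding cardV using cards by (intro power_increasing) auto
  finally have "card W < card V" .
  moreover have "finite W" unfolding W_def using E by (intro finite_PiE) auto
  ultimately have "\<not> inj_on \<Phi> V"
    using card_inj_on_le[OF _ maps] by fastforce
  then obtain p p' where pp: "p \<in> V" "p' \<in> V" "p \<noteq> p'" "\<Phi> p = \<Phi> p'"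
    unfolding inj_on_def by blast
  show ?thesis
  proof (intro exI[of _ "\<lambda>x. p x - p' x"] conjI ballI)
    fix e assume "e \<in> E"
    then have "(\<Sum>x\<in>X. a e x * p x) = (\<Sum>x\<in>X. a e x * p' x)"
      using fun_cong[OF pp(4), of e] by (simp add: \<Phi>_def)
    then show "(\<Sum>x\<in>X. a e x * (p x - p' x)) = 0"
      by (simp add: right_diff_distrib sum_subtractf)
  next
    fix x assume "x \<in> X"
    then have "0 \<le> p x" "p x \<le> int B" "0 \<le> p' x" "p' x \<le> int B"
      using pp by (auto simp: V_def)
    then show "\<bar>p x - p' x\<bar> \<le> int (2 * card X * A)" by (simp flip: B_def)
  next
    show "\<exists>x\<in>X. p x - p' x \<noteq> 0"
      using PiE_ext[OF pp(1,2)[unfolded V_def]] pp(3) by auto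
  qed
qed

definition acts_integrally :: "'i set \<Rightarrow> ('i \<Rightarrow> complex) \<Rightarrow> nat \<Rightarrow> complex \<Rightarrow> bool" where
  "acts_integrally I w B x \<longleftrightarrow>
     (\<exists>M :: 'i \<Rightarrow> 'i \<Rightarrow> int. \<forall>i\<in>I. x * w i = (\<Sum>j\<in>I. of_int (M i j) * w j) \<and>
        (\<Sum>j\<in>I. \<bar>M i j\<bar>) \<le> int B)"

lemma acts_integrallyE:
  assumes "acts_integrally I w B x"
  obtains M :: "'i \<Rightarrow> 'i \<Rightarrow> int" where
    "\<forall>i\<in>I. x * w i = (\<Sum>j\<in>I. of_int (M i j) * w j)" "\<forall>i\<in>I. (\<Sum>j\<in>I. \<bar>M i j\<bar>) \<le> int B"
  using assms unfolding acts_integrally_def ball_conj_distrib by (elim exE conjE)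

lemma acts_integrally_mono:
  assumes "acts_integrally I w B x" "B \<le> C"
  shows "acts_integrally I w C x"
proof -
  obtain M where "\<forall>i\<in>I. x * w i = (\<Sum>j\<in>I. of_int (M i j) * w j)"
      "\<forall>i\<in>I. (\<Sum>j\<in>I. \<bar>M i j\<bar>) \<le> int B"
    by (rule acts_integrallyE[OF assms(1)])
  note M = this[rule_format]
  show ?thesis unfolding acts_integrally_def
  proof (intro exI[of _ M] ballI conjI)
    fix i assume "i \<in> I"
    then show "(\<Sum>j\<in>I. \<bar>M i j\<bar>) \<le> int C" using M(2)[of i] assms(2) by linarith
  qed (rule M)
qed

lemma acts_integrally_of_int:
  assumes "finite I"
  shows "acts_integrally I w (nat \<bar>c\<bar>) (of_int c)"
  unfolding acts_integrally_def
proof (intro exI[of _ "\<lambda>i j. if j = i then c else 0"] ballI conjI)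
  fix i assume i: "i \<in> I"
  have "(\<Sum>j\<in>I. of_int (if j = i then c else 0) * w j) = (\<Sum>j\<in>I. if j = i then of_int c * w j else 0)"
    by (intro sum.cong) auto
  then show "of_int c * w i = (\<Sum>j\<in>I. of_int (if j = i then c else 0) * w j)"
    using assms i by simp
  have "(\<Sum>j\<in>I. \<bar>if j = i then c else 0\<bar>) = (\<Sum>j\<in>I. if j = i then \<bar>c\<bar> else 0)"
    by (intro sum.cong) auto
  then show "(\<Sum>j\<in>I. \<bar>if j = i then c else 0\<bar>) \<le> int (nat \<bar>c\<bar>)"
    using assms i by simp
qed

lemma acts_integrally_add:
  assumes "acts_integrally I w B x" "acts_integrally I w C y"
  shows "acts_integrally I w (B + C) (x + y)"
proof -
  obtain M where "\<forall>i\<in>I. x * w i = (\<Sum>j\<in>I. of_int (M i j) * w j)"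
      "\<forall>i\<in>I. (\<Sum>j\<in>I. \<bar>M i j\<bar>) \<le> int B"
    by (rule acts_integrallyE[OF assms(1)])
  note M = this[rule_format]
  obtain N where "\<forall>i\<in>I. y * w i = (\<Sum>j\<in>I. of_int (N i j) * w j)"
      "\<forall>i\<in>I. (\<Sum>j\<in>I. \<bar>N i j\<bar>) \<le> int C"
    by (rule acts_integrallyE[OF assms(2)])
  note N = this[rule_format]
  show ?thesis unfolding acts_integrally_def
  proof (intro exI[of _ "\<lambda>i j. M i j + N i j"] ballI conjI)
    fix i assume i: "i \<in> I"
    show "(x + y) * w i = (\<Sum>j\<in>I. of_int (M i j + N i j) * w j)"
      using M(1)[OF i] N(1)[OF i] by (simp add: distrib_right sum.distrib)
    have "(\<Sum>j\<in>I. \<bar>M i j + N i j\<bar>) \<le> (\<Sum>j\<in>I. \<bar>M i j\<bar> + \<bar>N i j\<bar>)"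
      by (intro sum_mono abs_triangle_ineq)
    also have "\<dots> \<le> int (B + C)"
      using M(2)[OF i] N(2)[OF i] by (simp add: sum.distrib)
    finally show "(\<Sum>j\<in>I. \<bar>M i j + N i j\<bar>) \<le> int (B + C)" .
  qed
qed

lemma acts_integrally_mult:
  assumes "acts_integrally I w B x" "acts_integrally I w C y"
  shows "acts_integrally I w (B * C) (x * y)"
proof -
  obtain M where "\<forall>i\<in>I. x * w i = (\<Sum>j\<in>I. of_int (M i j) * w j)"
      "\<forall>i\<in>I. (\<Sum>j\<in>I. \<bar>M i j\<bar>) \<le> int B"
    by (rule acts_integrallyE[OF assms(1)])
  note M = this[rule_format]
  obtain N where "\<forall>i\<in>I. y * w i = (\<Sum>j\<in>I. of_int (N i j) * w j)"
      "\<forall>i\<in>I. (\<Sum>j\<in>I. \<bar>N i j\<bar>) \<le> int C"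
    by (rule acts_integrallyE[OF assms(2)])
  note N = this[rule_format]
  show ?thesis unfolding acts_integrally_def
  proof (intro exI[of _ "\<lambda>i j. \<Sum>k\<in>I. N i k * M k j"] ballI conjI)
    fix i assume i: "i \<in> I"
    have "x * y * w i = (\<Sum>k\<in>I. of_int (N i k) * (x * w k))"
      using N(1)[OF i] by (simp add: mult.assoc sum_distrib_left mult.left_commute)
    also have "\<dots> = (\<Sum>k\<in>I. \<Sum>j\<in>I. of_int (N i k * M k j) * w j)"
      using M(1) by (intro sum.cong refl) (simp add: sum_distrib_left mult.assoc)
    also have "\<dots> = (\<Sum>j\<in>I. of_int (\<Sum>k\<in>I. N i k * M k j) * w j)"
      by (subst sum.swap) (simp add: sum_distrib_right)
    finally show "x * y * w i = (\<Sum>j\<in>I. of_int (\<Sum>k\<in>I. N i k * M k j) * w j)" .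
    have "(\<Sum>j\<in>I. \<bar>\<Sum>k\<in>I. N i k * M k j\<bar>) \<le> (\<Sum>j\<in>I. \<Sum>k\<in>I. \<bar>N i k\<bar> * \<bar>M k j\<bar>)"
      by (intro sum_mono order_trans[OF sum_abs]) (simp add: abs_mult)
    also have "\<dots> = (\<Sum>k\<in>I. \<bar>N i k\<bar> * (\<Sum>j\<in>I. \<bar>M k j\<bar>))"
      by (subst sum.swap) (simp add: sum_distrib_left)
    also have "\<dots> \<le> (\<Sum>k\<in>I. \<bar>N i k\<bar> * int B)"
      using M(2) by (intro sum_mono mult_left_mono) auto
    also have "\<dots> = (\<Sum>k\<in>I. \<bar>N i k\<bar>) * int B" by (simp add: sum_distrib_right)
    also have "\<dots> \<le> int C * int B" using N(2)[OF i] by (intro mult_right_mono) auto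
    finally show "(\<Sum>j\<in>I. \<bar>\<Sum>k\<in>I. N i k * M k j\<bar>) \<le> int (B * C)" by (simp add: mult.commute)
  qed
qed

lemma acts_integrally_power:
  assumes "finite I" "acts_integrally I w B x"
  shows "acts_integrally I w (B ^ k) (x ^ k)"
proof (induction k)
  case 0
  show ?case using acts_integrally_of_int[OF assms(1), of w 1] by simp
next
  case (Suc k)
  then show ?case using acts_integrally_mult[OF assms(2) Suc] by simp
qed

lemma acts_integrally_sum:
  assumes "finite I" "\<And>s. s \<in> S \<Longrightarrow> acts_integrally I w (B s) (x s)"
  shows "acts_integrally I w (\<Sum>s\<in>S. B s) (\<Sum>s\<in>S. x s)"
  using assms(2)
proof (induction S rule: infinite_finite_induct)
  case (insert s S)
  then show ?case by (simp add: acts_integrally_add)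
qed (use acts_integrally_of_int[OF assms(1), of w 0] in auto)

lemma acts_integrally_prod:
  assumes "finite I" "\<And>s. s \<in> S \<Longrightarrow> acts_integrally I w (B s) (x s)"
  shows "acts_integrally I w (\<Prod>s\<in>S. B s) (\<Prod>s\<in>S. x s)"
  using assms(2)
proof (induction S rule: infinite_finite_induct)
  case (insert s S)
  then show ?case by (simp add: acts_integrally_mult)
qed (use acts_integrally_of_int[OF assms(1), of w 1] in auto)

lemma acts_integrally_coords:
  assumes "finite I" "i \<in> I" "w i = 1" "acts_integrally I w B x"
  shows "\<exists>c :: 'i \<Rightarrow> int. x = (\<Sum>j\<in>I. of_int (c j) * w j) \<and> (\<forall>j\<in>I. \<bar>c j\<bar> \<le> int B)"
proof -
  obtain M where "\<forall>i\<in>I. x * w i = (\<Sum>j\<in>I. of_int (M i j) * w j)"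
      "\<forall>i\<in>I. (\<Sum>j\<in>I. \<bar>M i j\<bar>) \<le> int B"
    by (rule acts_integrallyE[OF assms(4)])
  note M = this[rule_format]
  have "\<bar>M i j\<bar> \<le> int B" if "j \<in> I" for j
    using member_le_sum[OF that, of "\<lambda>j. \<bar>M i j\<bar>"] assms(1) M(2)[OF assms(2)] by auto
  then show ?thesis using M(1)[OF assms(2)] assms(3) by (intro exI[of _ "M i"]) simp
qed

text \<open>
  Siegel's lemma gives a small integral relation between powers of \<open>x\<close>; dividing it by its lowest
  power of \<open>x\<close> leaves a nonzero integer which is a multiple of \<open>x\<close>.
\<close>

lemma liouville:
  assumes I: "finite I" "i \<in> I" "w i = 1" and x: "acts_integrally I w B x" "x \<noteq> 0" and B: "B \<ge> 1"
  shows "1 \<le> norm x * real (8 * card I ^ 2 * B ^ (2 * card I))"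
proof -
  define d where "d = card I"
  have d: "d \<ge> 1" using I unfolding d_def by (metis One_nat_def Suc_leI card_gt_0_iff empty_iff)
  have "\<exists>c. x ^ k = (\<Sum>j\<in>I. of_int (c j) * w j) \<and> (\<forall>j\<in>I. \<bar>c j\<bar> \<le> int (B ^ k))" for k
    by (rule acts_integrally_coords[OF I acts_integrally_power[OF I(1) x(1)]])
  then obtain c where c: "\<And>k. x ^ k = (\<Sum>j\<in>I. of_int (c k j) * w j)"
    "\<And>k j. j \<in> I \<Longrightarrow> \<bar>c k j\<bar> \<le> int (B ^ k)" by metis
  have "\<bar>c k j\<bar> \<le> int (B ^ (2 * d))" if "j \<in> I" "k \<in> {..<2*d}" for j k
  proof -
    have "B ^ k \<le> B ^ (2 * d)" using B that by (intro power_increasing) auto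
    then show ?thesis using c(2)[OF that(1), of k] by (meson of_nat_mono order_trans)
  qed
  moreover have "{..<2*d} \<noteq> {}" using d by (auto simp: lessThan_empty_iff)
  moreover have "2 * card I \<le> card {..<2*d}" "1 \<le> B ^ (2*d)" using B by (simp_all add: d_def)
  ultimately obtain p where
    "\<forall>j\<in>I. (\<Sum>k\<in>{..<2*d}. c k j * p k) = 0"
    "\<forall>k\<in>{..<2*d}. \<bar>p k\<bar> \<le> int (2 * card {..<2*d} * B ^ (2*d))"
    "\<exists>k\<in>{..<2*d}. p k \<noteq> 0"
    using siegel[of I "{..<2*d}" "B ^ (2*d)" "\<lambda>j k. c k j"] I(1) by blast
  then have p: "\<And>j. j \<in> I \<Longrightarrow> (\<Sum>k<2*d. c k j * p k) = 0"
       "\<And>k. k < 2*d \<Longrightarrow> \<bar>p k\<bar> \<le> int (2 * (2*d) * B ^ (2*d))" "\<exists>k<2*d. p k \<noteq> 0"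
    by auto
  have rel: "(\<Sum>k<2*d. of_int (p k) * x ^ k) = 0"
  proof -
    have "(\<Sum>k<2*d. of_int (p k) * x ^ k) = (\<Sum>j\<in>I. of_int (\<Sum>k<2*d. c k j * p k) * w j)"
      unfolding c(1) by (simp add: sum_distrib_left sum_distrib_right mult_ac) (rule sum.swap)
    then show ?thesis using p(1) by simp
  qed
  define k0 where "k0 = (LEAST k. k < 2*d \<and> p k \<noteq> 0)"
  have k0: "k0 < 2*d" "p k0 \<noteq> 0"
    using LeastI_ex[of "\<lambda>k. k < 2*d \<and> p k \<noteq> 0"] p(3) unfolding k0_def by auto
  have min: "p k = 0" if "k < k0" for k
    using not_less_Least[of k "\<lambda>k. k < 2*d \<and> p k \<noteq> 0"] that k0(1) unfolding k0_def[symmetric] by auto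
  define y where "y = (\<Sum>k\<in>{k0<..<2*d}. of_int (p k) * x ^ (k - Suc k0))"
  have "0 = (\<Sum>k\<in>{k0..<2*d}. of_int (p k) * x ^ k)"
    using rel min by (subst rel[symmetric], intro sum.mono_neutral_right) auto
  also have "\<dots> = of_int (p k0) * x ^ k0 + (\<Sum>k\<in>{k0<..<2*d}. of_int (p k) * x ^ k)"
    using k0 by (subst sum.atLeast_Suc_lessThan) (auto simp: atLeastSucLessThan_greaterThanLessThan)
  also have "(\<Sum>k\<in>{k0<..<2*d}. of_int (p k) * x ^ k) = x ^ Suc k0 * y"
    unfolding y_def sum_distrib_left
  proof (rule sum.cong)
    fix k assume "k \<in> {k0<..<2*d}"
    then have "k = Suc k0 + (k - Suc k0)" by simp
    then have "x ^ k = x ^ Suc k0 * x ^ (k - Suc k0)" by (metis power_add)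
    then show "of_int (p k) * x ^ k = x ^ Suc k0 * (of_int (p k) * x ^ (k - Suc k0))" by simp
  qed simp
  finally have "x ^ k0 * (of_int (p k0) + x * y) = 0" by (simp add: algebra_simps)
  then have pk0: "of_int (p k0) = - (x * y)" using x(2) by (simp add: eq_neg_iff_add_eq_0)
  have one: "1 \<le> norm x * norm y"
  proof -
    have "1 \<le> \<bar>real_of_int (p k0)\<bar>" using k0(2) by linarith
    also have "\<dots> = norm (of_int (p k0) :: complex)" by simp
    also have "\<dots> = norm x * norm y" unfolding pk0 by (simp add: norm_mult)
    finally show ?thesis .
  qed
  have "0 < 8 * d ^ 2 * B ^ (2 * d)" using d B by simp
  then have big: "1 \<le> real (8 * d ^ 2 * B ^ (2 * d))" by linarith
  show ?thesis
  proof (cases "norm x \<le> 1")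
    case True
    have "norm y \<le> (\<Sum>k\<in>{k0<..<2*d}. norm (of_int (p k) * x ^ (k - Suc k0)))"
      unfolding y_def by (rule norm_sum)
    also have "\<dots> \<le> (\<Sum>k\<in>{k0<..<2*d}. real (2 * (2*d) * B ^ (2*d)))"
    proof (rule sum_mono)
      fix k assume "k \<in> {k0<..<2*d}"
      then have "real_of_int \<bar>p k\<bar> \<le> real_of_int (int (2 * (2*d) * B ^ (2*d)))"
        using p(2)[of k] by (simp only: of_int_le_iff greaterThanLessThan_iff)
      then have "norm (of_int (p k) :: complex) \<le> real (2 * (2*d) * B ^ (2*d))" by simp
      moreover have "norm (x ^ (k - Suc k0)) \<le> 1"
        using True by (simp add: norm_power power_le_one)
      ultimately show "norm (of_int (p k) * x ^ (k - Suc k0)) \<le> real (2 * (2*d) * B ^ (2*d))"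
        unfolding norm_mult by (metis mult.right_neutral mult_mono norm_ge_zero of_nat_0_le_iff)
    qed
    also have "\<dots> \<le> real (2*d) * real (2 * (2*d) * B ^ (2*d))"
      unfolding sum_constant by (intro mult_right_mono) auto
    also have "\<dots> = real (8 * d ^ 2 * B ^ (2 * d))" by (simp add: power2_eq_square)
    finally show ?thesis
      unfolding d_def[symmetric] using one by (meson mult_left_mono norm_ge_zero order_trans)
  next
    case False
    then show ?thesis unfolding d_def[symmetric]
      using mult_mono[of 1 "norm x", OF _ big] by simp
  qed
qed

lemma algebraic_integral_multiple:
  assumes "algebraic (x :: complex)"
  shows "\<exists>(D::int) (n::nat) c. D \<noteq> 0 \<and> n > 0 \<and>
    (of_int D * x) ^ n = (\<Sum>j<n. of_int (c j :: int) * (of_int D * x) ^ j)"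
proof -
  from assms obtain p where p: "poly (map_poly of_int p) x = 0" "p \<noteq> 0"
    by (auto elim: algebraicE')
  define n where "n = degree p"
  define D where "D = lead_coeff p"
  have D: "D \<noteq> 0" using p by (simp add: D_def)
  have sum0: "(\<Sum>i\<le>n. of_int (coeff p i) * x ^ i) = 0"
    using p(1) by (simp add: poly_altdef degree_map_poly coeff_map_poly n_def)
  have n: "n > 0"
  proof (rule ccontr)
    assume "\<not> n > 0"
    then show False using sum0 D by (simp add: D_def n_def)
  qed
  have "{..n} = insert n {..<n}" by auto
  then have "of_int (coeff p n) * x ^ n + (\<Sum>i<n. of_int (coeff p i) * x ^ i) = 0"
    using sum0 by simp
  then have lead: "of_int D * x ^ n = - (\<Sum>i<n. of_int (coeff p i) * x ^ i)"
    unfolding D_def n_def[symmetric] by (rule iffD2[OF eq_neg_iff_add_eq_0])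
  have "(of_int D * x) ^ n = of_int D ^ (n - 1) * (of_int D * x ^ n)"
    by (cases n) (use n in \<open>simp_all add: power_mult_distrib\<close>)
  also have "\<dots> = (\<Sum>i<n. of_int (- coeff p i * D ^ (n - 1 - i)) * (of_int D * x) ^ i)"
    unfolding lead mult_minus_right sum_distrib_left sum_negf[symmetric]
  proof (rule sum.cong)
    fix i assume "i \<in> {..<n}"
    then have "n - 1 = (n - 1 - i) + i" by auto
    then have "(of_int D :: complex) ^ (n - 1) = of_int D ^ (n - 1 - i) * of_int D ^ i"
      by (metis power_add)
    then show "- (of_int D ^ (n - 1) * (of_int (coeff p i) * x ^ i)) =
        of_int (- coeff p i * D ^ (n - 1 - i)) * (of_int D * x) ^ i"
      by (simp add: power_mult_distrib)
  qed simp
  finally show ?thesis using D n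
    by (intro exI[of _ D] exI[of _ n] exI[of _ "\<lambda>i. - coeff p i * D ^ (n - 1 - i)"] conjI)
qed

text \<open>
  The monomials in the generators with exponents below the degrees span over the integers a module
  stable under multiplication by the generators.
\<close>

lemma acts_integrally_monomials:
  fixes y :: "'a \<Rightarrow> complex"
  assumes A: "finite A" and deg: "\<And>a. a \<in> A \<Longrightarrow> deg a > 0"
    and rel: "\<And>a. a \<in> A \<Longrightarrow> y a ^ deg a = (\<Sum>j<deg a. of_int (c a j) * y a ^ j)"
    and a: "a \<in> A"
  shows "\<exists>B. acts_integrally (PiE A (\<lambda>a. {..<deg a})) (\<lambda>e. \<Prod>b\<in>A. y b ^ e b) B (y a)"
proof -
  define I where "I = PiE A (\<lambda>a. {..<deg a})"
  define w where "w = (\<lambda>e. \<Prod>b\<in>A. y b ^ e b)"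
  have finI: "finite I" unfolding I_def using A by (intro finite_PiE) auto
  have upd: "w (e(a := k)) = y a ^ k * (\<Prod>b\<in>A - {a}. y b ^ e b)" for e k
    unfolding w_def using A a by (simp add: prod.remove[of A a] cong: prod.cong_simp)
  have updI: "e(a := k) \<in> I" if "e \<in> I" "k < deg a" for e k
    using that a by (auto simp: I_def PiE_iff extensional_def)
  have ex: "\<exists>M :: ('a \<Rightarrow> nat) \<Rightarrow> int. y a * w e = (\<Sum>e'\<in>I. of_int (M e') * w e')" if e: "e \<in> I" for e
  proof (cases "Suc (e a) < deg a")
    case True
    have "y a * w e = w (e(a := Suc (e a)))"
      using upd[of e "Suc (e a)"] upd[of e "e a"] by simp
    also have "\<dots> = (\<Sum>e'\<in>I. if e' = e(a := Suc (e a)) then w e' else 0)"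
      using finI updI[OF e True] by simp
    also have "\<dots> = (\<Sum>e'\<in>I. of_int (if e' = e(a := Suc (e a)) then 1 else 0) * w e')"
      by (intro sum.cong) auto
    finally show ?thesis by - (rule exI)
  next
    case False
    then have ea: "deg a = Suc (e a)" using e a by (auto simp: I_def PiE_iff)
    have "y a * w e = y a ^ deg a * (\<Prod>b\<in>A - {a}. y b ^ e b)"
      using upd[of e "e a"] ea by simp
    also have "\<dots> = (\<Sum>j<deg a. of_int (c a j) * w (e(a := j)))"
      by (simp add: rel[OF a] sum_distrib_right upd mult.assoc)
    also have "\<dots> = (\<Sum>j<deg a. \<Sum>e'\<in>I. of_int (if e' = e(a := j) then c a j else 0) * w e')"
    proof (rule sum.cong)
      fix j assume "j \<in> {..<deg a}"
      then have "(\<Sum>e'\<in>I. if e' = e(a := j) then of_int (c a j) * w e' else 0)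
          = of_int (c a j) * w (e(a := j))" using finI updI[OF e, of j] by simp
      also have "(\<Sum>e'\<in>I. if e' = e(a := j) then of_int (c a j) * w e' else 0) =
          (\<Sum>e'\<in>I. of_int (if e' = e(a := j) then c a j else 0) * w e')"
        by (intro sum.cong) auto
      finally show "of_int (c a j) * w (e(a := j)) =
         (\<Sum>e'\<in>I. of_int (if e' = e(a := j) then c a j else 0) * w e')" ..
    qed simp
    also have "\<dots> = (\<Sum>e'\<in>I. of_int (\<Sum>j<deg a. if e' = e(a := j) then c a j else 0) * w e')"
      by (subst sum.swap) (simp add: sum_distrib_right)
    finally show ?thesis by - (rule exI)
  qed
  have "\<forall>e\<in>I. \<exists>M :: ('a \<Rightarrow> nat) \<Rightarrow> int. y a * w e = (\<Sum>e'\<in>I. of_int (M e') * w e')" by (intro ballI ex)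
  from bchoice[OF this] obtain M :: "('a \<Rightarrow> nat) \<Rightarrow> ('a \<Rightarrow> nat) \<Rightarrow> int"
    where M: "\<forall>e\<in>I. y a * w e = (\<Sum>e'\<in>I. of_int (M e e') * w e')" ..
  have "acts_integrally I w (nat (\<Sum>e\<in>I. \<Sum>e'\<in>I. \<bar>M e e'\<bar>)) (y a)"
    unfolding acts_integrally_def
  proof (intro exI[of _ M] ballI conjI)
    fix e assume e: "e \<in> I"
    have "(\<Sum>e'\<in>I. \<bar>M e e'\<bar>) \<le> (\<Sum>e\<in>I. \<Sum>e'\<in>I. \<bar>M e e'\<bar>)"
      using e finI by (intro member_le_sum[of e I "\<lambda>e. \<Sum>e'\<in>I. \<bar>M e e'\<bar>"]) (auto intro: sum_nonneg)
    then show "(\<Sum>e'\<in>I. \<bar>M e e'\<bar>) \<le> int (nat (\<Sum>e\<in>I. \<Sum>e'\<in>I. \<bar>M e e'\<bar>))" by linarith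
  qed (rule bspec[OF M])
  then show ?thesis unfolding I_def w_def by (rule exI)
qed

lemma common_integral_action:
  fixes x :: "'a \<Rightarrow> complex"
  assumes A: "finite A" and alg: "\<And>a. a \<in> A \<Longrightarrow> algebraic (x a)"
  shows "\<exists>(I :: ('a \<Rightarrow> nat) set) w i (D::int) B. finite I \<and> i \<in> I \<and> w i = 1 \<and> D \<noteq> 0 \<and>
    (\<forall>a\<in>A. acts_integrally I w B (of_int D * x a))"
proof -
  have "\<forall>a\<in>A. \<exists>D n c. D \<noteq> 0 \<and> n > 0 \<and> (of_int D * x a) ^ n = (\<Sum>j<n. of_int (c j) * (of_int D * x a) ^ j)"
    by (intro ballI algebraic_integral_multiple alg)
  then obtain D n c where D: "\<forall>a\<in>A. D a \<noteq> 0 \<and> n a > 0 \<and>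
      (of_int (D a) * x a) ^ n a = (\<Sum>j<n a. of_int (c a j) * (of_int (D a) * x a) ^ j)"
    unfolding bchoice_iff by (elim exE)
  define y where "y = (\<lambda>a. of_int (D a) * x a)"
  define I where "I = PiE A (\<lambda>a. {..<n a})"
  define w where "w = (\<lambda>e. \<Prod>b\<in>A. y b ^ e b)"
  have finI: "finite I" unfolding I_def using A by (intro finite_PiE) auto
  have "\<forall>a\<in>A. \<exists>B. acts_integrally I w B (y a)"
    unfolding I_def w_def using D
    by (intro ballI acts_integrally_monomials[OF A, where c = c]) (auto simp: y_def)
  then obtain B where B: "\<forall>a\<in>A. acts_integrally I w (B a) (y a)"
    unfolding bchoice_iff by (elim exE)
  define E where "E = (\<Prod>a\<in>A. D a)"
  define C where "C = (\<Sum>a\<in>A. nat \<bar>\<Prod>b\<in>A-{a}. D b\<bar> * B a)"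
  have "acts_integrally I w C (of_int E * x a)" if a: "a \<in> A" for a
  proof -
    have "E = (\<Prod>b\<in>A-{a}. D b) * D a"
      unfolding E_def using prod.remove[OF A a, of D] by simp
    then have eq: "of_int E * x a = of_int (\<Prod>b\<in>A-{a}. D b) * y a" by (simp add: y_def)
    have "acts_integrally I w (nat \<bar>\<Prod>b\<in>A-{a}. D b\<bar> * B a) (of_int E * x a)"
      unfolding eq using a B by (intro acts_integrally_mult acts_integrally_of_int finI) simp
    moreover have "nat \<bar>\<Prod>b\<in>A-{a}. D b\<bar> * B a \<le> C"
      unfolding C_def using A a by (intro member_le_sum[of a A "\<lambda>a. nat \<bar>\<Prod>b\<in>A-{a}. D b\<bar> * B a"]) auto
    ultimately show ?thesis by (rule acts_integrally_mono)
  qed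
  moreover have "(\<lambda>a\<in>A. 0) \<in> I" using D by (auto simp: I_def)
  moreover have "w (\<lambda>a\<in>A. 0) = 1" by (simp add: w_def)
  moreover have "E \<noteq> 0" using D A by (simp add: E_def)
  ultimately show ?thesis using finI by (intro exI[of _ I] exI[of _ w] exI[of _ "\<lambda>a\<in>A. 0"] exI[of _ E] exI[of _ C]) simp
qed

section \<open>Zeros of exponential sums\<close>

lemma tendsto_div_power_of_derivs_zero:
  assumes f: "f analytic_on {a}" and zero: "\<And>j. j < t \<Longrightarrow> (deriv ^^ j) f a = 0"
  shows "\<exists>c. (\<lambda>z. f z / (z - a) ^ t) \<midarrow>a\<rightarrow> c"
proof -
  define F where "F = fps_expansion f a"
  have F: "(\<lambda>x. f (a + x)) has_fps_expansion F"
    unfolding F_def by (rule analytic_at_imp_has_fps_expansion[OF f])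
  have nth: "fps_nth F j = 0" if "j < t" for j
    using zero[OF that] by (simp add: F_def fps_expansion_def)
  have "\<exists>g c. (\<lambda>x. if x = 0 then c else f (a + x) / x ^ t) has_fps_expansion g"
  proof (cases "F = 0")
    case True
    then have "eventually (\<lambda>x. f (a + x) = 0) (nhds 0)"
      using F by (simp add: has_fps_expansion_0_iff)
    then have "eventually (\<lambda>x. (if x = 0 then 0 else f (a + x) / x ^ t) = 0) (nhds 0)"
      by eventually_elim simp
    then have "(\<lambda>x. if x = 0 then 0 else f (a + x) / x ^ t) has_fps_expansion 0"
      by (simp only: has_fps_expansion_0_iff)
    then show ?thesis by (intro exI)
  next
    case False
    then have "t \<le> subdegree F" using nth by (intro subdegree_geI) auto
    from has_fps_expansion_shift[OF F this refl] show ?thesis by (intro exI)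
  qed
  then obtain g c where "(\<lambda>x. if x = 0 then c else f (a + x) / x ^ t) has_fps_expansion g"
    by (elim exE)
  then have "isCont (\<lambda>x. if x = 0 then c else f (a + x) / x ^ t) 0"
    by (intro analytic_at_imp_isCont has_fps_expansion_imp_analytic_0)
  then have "((\<lambda>x. if x = 0 then c else f (a + x) / x ^ t) \<longlongrightarrow> c) (at 0)"
    by (simp add: isCont_def)
  then have "((\<lambda>x. f (a + x) / x ^ t) \<longlongrightarrow> c) (at 0)"
    by (rule Lim_transform_eventually) (auto simp: eventually_at_filter)
  then have "((\<lambda>z. f z / (z - a) ^ t) \<longlongrightarrow> c) (at a)"
    by (subst at_to_0) (simp add: filterlim_filtermap add.commute)
  then show ?thesis by (rule exI)
qed

text \<open>
  The maximum principle is applied to the quotient of \<open>f\<close> by the polynomial with the given zeros.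
\<close>

lemma norm_le_of_many_zeros:
  fixes f :: "complex \<Rightarrow> complex" and A C R M :: real
  assumes f: "f holomorphic_on UNIV"
    and zero: "\<And>l j. l < h \<Longrightarrow> j < t \<Longrightarrow> (deriv ^^ j) f (of_nat l) = 0"
    and M: "\<And>z. norm z = R \<Longrightarrow> norm (f z) \<le> M"
    and y: "norm y \<le> R" "\<And>l. l < h \<Longrightarrow> norm (y - of_nat l) \<le> A"
    and C: "0 < C" "real h + C \<le> R"
  shows "norm (f y) \<le> M * (A / C) ^ (h * t)"
proof -
  define g where "g = (\<lambda>z::complex. \<Prod>l<h. (z - of_nat l) ^ t)"
  define G where "G = remove_sings (\<lambda>z. f z / g z)"
  have fan: "f analytic_on S" for S
    using f by (metis analytic_on_open analytic_on_subset open_UNIV subset_UNIV)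
  have gan: "g analytic_on S" for S unfolding g_def by (intro analytic_intros)
  have gnz: "g z \<noteq> 0" if "\<And>l. l < h \<Longrightarrow> z \<noteq> of_nat l" for z
    using that by (auto simp: g_def)
  have R: "R > 0" using C by linarith
  have M0: "M \<ge> 0" using order_trans[OF norm_ge_zero M[of "of_real R"]] R by simp
  have quot: "(\<lambda>z. f z / g z) analytic_on {z}" if "g z \<noteq> 0" for z
    using that by (intro analytic_intros fan gan) auto
  have Gan: "G analytic_on {z}" for z
  proof (cases "g z = 0")
    case False
    then show ?thesis unfolding G_def by (intro remove_sings_analytic_on quot)
  next
    case True
    then obtain l where l: "l < h" "z = of_nat l" using gnz by blast
    define k where "k = (\<lambda>z::complex. \<Prod>m\<in>{..<h}-{l}. (z - of_nat m) ^ t)"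
    have gk: "g z = (z - of_nat l) ^ t * k z" for z
      unfolding g_def k_def using l(1) by (subst prod.remove[of _ l]) auto
    have kz: "k z \<noteq> 0" using l by (auto simp: k_def)
    have "k \<midarrow>z\<rightarrow> k z"
      unfolding k_def by (intro tendsto_intros)
    moreover obtain c where "(\<lambda>x. f x / (x - z) ^ t) \<midarrow>z\<rightarrow> c"
      using tendsto_div_power_of_derivs_zero[OF fan, of t z] zero[OF l(1)] l(2) by auto
    ultimately have "(\<lambda>x. f x / (x - z) ^ t / k x) \<midarrow>z\<rightarrow> c / k z"
      using kz by (intro tendsto_divide)
    then have lim: "(\<lambda>x. f x / g x) \<midarrow>z\<rightarrow> c / k z" by (simp add: gk l(2))
    have "(\<lambda>x. f x / g x) meromorphic_on {z}"
      by (intro meromorphic_on_divide analytic_on_imp_meromorphic_on fan gan)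
    then have "isolated_singularity_at (\<lambda>x. f x / g x) z"
      by (simp add: meromorphic_at_iff)
    then show ?thesis unfolding G_def using lim by (intro remove_sings_analytic_at)
  qed
  then have Ghol: "G holomorphic_on S" for S
    by (metis analytic_imp_holomorphic analytic_on_analytic_at)
  have Gq: "G z = f z / g z" if "g z \<noteq> 0" for z
    unfolding G_def using quot[OF that] by (rule remove_sings_at_analytic)
  have gR: "C ^ (h * t) \<le> norm (g z)" if "norm z = R" for z
  proof -
    have "C ^ (h * t) = (\<Prod>l<h. C ^ t)" by (simp add: mult.commute flip: power_mult)
    also have "\<dots> \<le> (\<Prod>l<h. norm (z - of_nat l) ^ t)"
    proof (intro prod_mono conjI power_mono)
      fix l assume "l \<in> {..<h}"
      then have "real l \<le> real h" by simp
      then show "C \<le> norm (z - of_nat l)"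
        using norm_triangle_ineq2[of z "of_nat l"] that C by simp
    qed (use C in auto)
    finally show ?thesis by (simp add: g_def norm_power flip: prod_norm)
  qed
  have GR: "norm (G z) \<le> M / C ^ (h * t)" if "norm z = R" for z
  proof -
    have pos: "0 < C ^ (h * t)" using C by simp
    then have "g z \<noteq> 0" using gR[OF that] by auto
    then have "norm (G z) = norm (f z) / norm (g z)" by (simp add: Gq norm_divide)
    also have "\<dots> \<le> M / C ^ (h * t)"
      using gR[OF that] M[OF that] pos M0 by (intro frac_le) auto
    finally show ?thesis .
  qed
  have Gy: "norm (G y) \<le> M / C ^ (h * t)"
  proof (rule maximum_modulus_frontier[of G "cball 0 R"])
    show "continuous_on (closure (cball 0 R)) G"
      by (intro holomorphic_on_imp_continuous_on Ghol)
    show "norm (G z) \<le> M / C ^ (h * t)" if "z \<in> frontier (cball 0 R)" for z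
      using that R by (intro GR) (simp add: frontier_cball)
  qed (use Ghol y in auto)
  show ?thesis
  proof (cases "g y = 0")
    case True
    then obtain l where l: "l < h" "y = of_nat l" "t > 0"
      by (auto simp: g_def)
    then have "f y = 0" using zero[of l 0] by simp
    moreover have "A \<ge> 0" using y(2)[OF l(1)] by (meson norm_ge_zero order_trans)
    ultimately show ?thesis using M0 C by simp
  next
    case False
    have "norm (g y) = (\<Prod>l<h. norm (y - of_nat l) ^ t)" by (simp add: g_def norm_power flip: prod_norm)
    also have "\<dots> \<le> (\<Prod>l<h. A ^ t)" using y by (intro prod_mono conjI power_mono) auto
    also have "\<dots> = A ^ (h * t)" by (simp add: mult.commute flip: power_mult)
    finally have gA: "norm (g y) \<le> A ^ (h * t)" .
    have "norm (f y) = norm (G y) * norm (g y)" using Gq[OF False] False by (simp add: norm_divide)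
    also have "\<dots> \<le> M / C ^ (h * t) * A ^ (h * t)"
      using Gy gA M0 C by (intro mult_mono) auto
    finally show ?thesis by (simp add: power_divide)
  qed
qed

lemma higher_deriv_exp_sum:
  "(deriv ^^ j) (\<lambda>z. \<Sum>x\<in>X. c x * exp (w x * z)) = (\<lambda>z. \<Sum>x\<in>X. c x * w x ^ j * exp (w x * z :: complex))"
proof (induction j)
  case (Suc j)
  have "deriv (\<lambda>z. \<Sum>x\<in>X. c x * w x ^ j * exp (w x * z)) z =
      (\<Sum>x\<in>X. c x * w x ^ Suc j * exp (w x * z))" for z
    by (rule DERIV_imp_deriv) (auto intro!: derivative_eq_intros sum.cong)
  then show ?case using Suc by simp
qed simp

text \<open>
  Test the vanishing sums against the polynomial whose roots are all nodes but one.
\<close>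

lemma vanishing_power_sums:
  fixes x :: "'a \<Rightarrow> complex"
  assumes S: "finite S" "inj_on x S"
    and zero: "\<And>l. l < card S \<Longrightarrow> (\<Sum>s\<in>S. c s * x s ^ l) = 0" and s: "s \<in> S"
  shows "c s = 0"
proof -
  define Q where "Q = (\<Prod>r\<in>S-{s}. [:- x r, 1:])"
  have "degree Q \<le> (\<Sum>r\<in>S-{s}. degree [:- x r, 1:])" 
    unfolding Q_def using degree_prod_sum_le[of "S-{s}" "\<lambda>r. [:- x r, 1:]"] S by (simp add: o_def)
  also have "\<dots> = card S - 1" using S s by simp
  also have "\<dots> < card S" using S s by (metis card_gt_0_iff diff_less empty_iff zero_less_one)
  finally have deg: "degree Q < card S" .
  have "(\<Sum>r\<in>S. c r * poly Q (x r)) = (\<Sum>r\<in>S. \<Sum>l\<le>degree Q. coeff Q l * (c r * x r ^ l))"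
    by (simp add: poly_altdef sum_distrib_left mult_ac)
  also have "\<dots> = (\<Sum>l\<le>degree Q. coeff Q l * (\<Sum>r\<in>S. c r * x r ^ l))"
    by (subst sum.swap) (simp add: sum_distrib_left)
  also have "\<dots> = 0" using zero deg by simp
  also have "(\<Sum>r\<in>S. c r * poly Q (x r)) = c s * poly Q (x s) + (\<Sum>r\<in>S-{s}. c r * poly Q (x r))"
    using S s by (simp add: sum.remove)
  also have "(\<Sum>r\<in>S-{s}. c r * poly Q (x r)) = 0"
    using S by (intro sum.neutral) (auto simp: Q_def poly_prod)
  finally have "c s * poly Q (x s) = 0" by simp
  moreover have "poly Q (x s) \<noteq> 0"
    using S s by (auto simp: Q_def poly_prod inj_on_def)
  ultimately show ?thesis by simp
qed

section \<open>Baker's theorem for logarithms of integers\<close>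

lemma eventually_power_decay:
  fixes M :: real and e :: nat
  shows "eventually (\<lambda>q::nat. M * real q ^ e * (2 / real q) ^ q < 1) at_top"
proof -
  have "((\<lambda>q::nat. M * real q ^ e * (2 / real q) ^ q) \<longlongrightarrow> 0) at_top"
    by real_asymp
  then show ?thesis by (rule order_tendstoD) simp
qed

text \<open>
  Here \<open>L ^ n\<close> exceeds a constant multiple of \<open>T ^ (n-1) * q\<close>, the number of equations, while
  \<open>L * (q^2 * h) = h * t / q\<close>, so that the growth on the circle of radius \<open>q^2 * h\<close> is negligible
  compared with the gain from \<open>h\<close> zeros of order \<open>t\<close>.
\<close>

lemma auxiliary_parameters_bound:
  fixes q C d n K J :: nat
  defines "t \<equiv> q ^ (3*n+2)" and "L \<equiv> q ^ (3*n-1)" and "h \<equiv> q ^ (J+1)"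
  defines "T \<equiv> K * t"
  assumes q: "q \<ge> 1" and C: "C \<ge> 1" and n: "n \<ge> 1"
    and small: "real ((8 * d^2 + 1) * C ^ K * (2 * C ^ (2*K+2)) ^ (2*d+1)) *
      real q ^ ((6*n^2 + 6*n*K) * (2*d+1)) * (2 / real q) ^ q < 1"
  shows "real (8 * d^2 * C ^ T *
      (L^n * (2 * L^n * ((C*L)^T * C^(L*q))) * (C*L)^T * C^(L*(q^2*h))) ^ (2*d+1)) * (2 / real q) ^ (h*t) < 1"
proof -
  define u where "u = q ^ J * t"
  have L1: "L \<ge> 1" and t1: "t \<ge> 1" and u1: "u \<ge> 1" using q by (simp_all add: L_def t_def u_def)
  have tu: "t \<le> u" using q by (simp add: u_def)
  have Lq: "L \<le> q ^ (3*n)" unfolding L_def using q by (intro power_increasing) auto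
  have "3*n-1 + (2 + (J+1)) = J + (3*n+2)" using n by simp
  then have LR: "L * (q^2*h) = u"
    unfolding L_def h_def u_def t_def power_add[symmetric] by (rule arg_cong)
  have ht: "h * t = q * u" by (simp add: h_def u_def)
  have "L * q \<le> L * (q^2*h)" using q by (simp add: h_def power2_eq_square)
  then have CLq: "C^(L*q) \<le> C^u" using C LR by (intro power_increasing) auto
  have up: "x \<le> x ^ u" if "x \<ge> 1" for x :: nat using that u1 by (simp add: self_le_power)
  have Ln: "L^n \<le> (q ^ (3*n^2)) ^ u"
  proof -
    have "L^n \<le> (q ^ (3*n)) ^ n" using Lq by (intro power_mono) auto
    also have "\<dots> = q ^ (3*n^2)" by (simp add: power2_eq_square mult_ac flip: power_mult)
    also have "\<dots> \<le> (q ^ (3*n^2)) ^ u" using q by (intro up) simp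
    finally show ?thesis .
  qed
  have CLT: "(C*L)^T \<le> (C^K * q^(3*n*K)) ^ u"
  proof -
    have "(C*L)^T \<le> (C * q^(3*n))^T" using Lq by (intro power_mono mult_le_mono) auto
    also have "\<dots> = ((C * q^(3*n))^K)^t" by (simp add: T_def power_mult)
    also have "\<dots> \<le> ((C * q^(3*n))^K)^u" using tu q C by (intro power_increasing) auto
    also have "(C * q^(3*n))^K = C^K * q^(3*n*K)" by (simp add: power_mult_distrib power_mult)
    finally show ?thesis .
  qed
  have CT: "C^T \<le> (C^K)^u"
    unfolding T_def power_mult using tu C by (intro power_increasing) auto
  define b where "b = 2 * C ^ (2*K+2) * q ^ (6*n^2 + 6*n*K)"
  have "L^n * (2 * L^n * ((C*L)^T * C^(L*q))) * (C*L)^T * C^(L*(q^2*h)) \<le>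
     (q ^ (3*n^2)) ^ u * (2^u * (q ^ (3*n^2)) ^ u * ((C^K * q^(3*n*K)) ^ u * C^u)) * (C^K * q^(3*n*K)) ^ u * C^u"
    unfolding LR by (intro mult_le_mono Ln CLT CLq up) auto
  also have "\<dots> = (q ^ (3*n^2) * (2 * q ^ (3*n^2) * (C^K * q^(3*n*K) * C)) * (C^K * q^(3*n*K)) * C) ^ u"
    by (simp only: power_mult_distrib)
  also have "q ^ (3*n^2) * (2 * q ^ (3*n^2) * (C^K * q^(3*n*K) * C)) * (C^K * q^(3*n*K)) * C =
      2 * (C^K * C^K * C^2) * (q ^ (3*n^2) * q ^ (3*n^2) * q^(3*n*K) * q^(3*n*K))"
    by (simp add: power2_eq_square mult_ac)
  also have "C^K * C^K * C^2 = C ^ (2*K+2)" by (simp add: mult_2 power_add flip: power2_eq_square)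
  also have "q ^ (3*n^2) * q ^ (3*n^2) * q^(3*n*K) * q^(3*n*K) = q ^ (6*n^2 + 6*n*K)"
    unfolding power_add[symmetric] by (rule arg_cong[where f = "power q"]) simp
  finally have B: "L^n * (2 * L^n * ((C*L)^T * C^(L*q))) * (C*L)^T * C^(L*(q^2*h)) \<le> b ^ u"
    by (simp add: b_def)
  have d8: "8 * d^2 \<le> (8 * d^2 + 1) ^ u"
    using up[of "8 * d^2 + 1"] by linarith
  have "8 * d^2 * C ^ T *
      (L^n * (2 * L^n * ((C*L)^T * C^(L*q))) * (C*L)^T * C^(L*(q^2*h))) ^ (2*d+1)
     \<le> (8 * d^2 + 1) ^ u * (C^K)^u * (b ^ u) ^ (2*d+1)"
    by (intro mult_le_mono d8 CT power_mono[OF B]) auto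
  also have "(b ^ u) ^ (2*d+1) = (b ^ (2*d+1)) ^ u" by (simp only: mult.commute flip: power_mult)
  also have "(8 * d^2 + 1) ^ u * (C^K)^u * (b ^ (2*d+1)) ^ u = ((8 * d^2 + 1) * C^K * b ^ (2*d+1)) ^ u"
    by (simp only: power_mult_distrib)
  finally have "real (8 * d^2 * C ^ T *
      (L^n * (2 * L^n * ((C*L)^T * C^(L*q))) * (C*L)^T * C^(L*(q^2*h))) ^ (2*d+1)) * (2 / real q) ^ (h*t)
     \<le> real (((8 * d^2 + 1) * C^K * b ^ (2*d+1)) ^ u) * (2 / real q) ^ (h*t)"
    by (intro mult_right_mono of_nat_mono) auto
  also have "\<dots> = (real ((8 * d^2 + 1) * C^K * b ^ (2*d+1)) * (2 / real q) ^ q) ^ u"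
    unfolding ht power_mult[of "2 / real q" q u] of_nat_power[of _ u] by (rule power_mult_distrib[symmetric])
  also have "real ((8 * d^2 + 1) * C^K * b ^ (2*d+1)) * (2 / real q) ^ q =
    real ((8 * d^2 + 1) * C ^ K * (2 * C ^ (2*K+2)) ^ (2*d+1)) *
      real q ^ ((6*n^2 + 6*n*K) * (2*d+1)) * (2 / real q) ^ q"
    unfolding b_def by (simp only: power_mult_distrib power_mult of_nat_mult of_nat_power mult.assoc)
  also have "\<dots> ^ u < 1"
    using small u1 by (intro power_less_one_iff[THEN iffD2] conjI) auto
  finally show ?thesis .
qed

locale log_relation =
  fixes A :: "nat set" and r :: nat and \<beta> :: "nat \<Rightarrow> complex"
  assumes finite_A: "finite A" and pos: "a \<in> A \<Longrightarrow> a \<ge> 1" and r: "r \<in> A"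
    and relation: "complex_of_real (ln (real r)) = (\<Sum>a\<in>A-{r}. \<beta> a * of_real (ln (real a)))"
    and alg: "a \<in> A - {r} \<Longrightarrow> algebraic (\<beta> a)"
    and indep: "inj_on (\<lambda>e. \<Prod>a\<in>A. a ^ e a) (PiE A (\<lambda>_. UNIV))"
begin

definition exponents :: "nat \<Rightarrow> (nat \<Rightarrow> nat) set" where
  "exponents L = PiE A (\<lambda>_. {..<L})"

definition node :: "(nat \<Rightarrow> nat) \<Rightarrow> nat" where
  "node e = (\<Prod>a\<in>A. a ^ e a)"

definition freq :: "(nat \<Rightarrow> nat) \<Rightarrow> complex" where
  "freq e = of_real (ln (real (node e)))"

definition gam :: "(nat \<Rightarrow> nat) \<Rightarrow> nat \<Rightarrow> complex" where
  "gam e a = of_nat (e a) + of_nat (e r) * \<beta> a"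

definition gam_monomial :: "(nat \<Rightarrow> nat) \<Rightarrow> (nat \<Rightarrow> nat) \<Rightarrow> complex" where
  "gam_monomial \<mu> e = (\<Prod>a\<in>A-{r}. gam e a ^ \<mu> a)"

text \<open>
  Up to powers of the numbers \<open>ln a\<close> these are the values on the diagonal of the partial derivatives
  of Baker's auxiliary function in several variables.
\<close>

definition aux :: "nat \<Rightarrow> ((nat \<Rightarrow> nat) \<Rightarrow> int) \<Rightarrow> (nat \<Rightarrow> nat) \<Rightarrow> complex \<Rightarrow> complex" where
  "aux L p \<mu> z = (\<Sum>e\<in>exponents L. of_int (p e) * gam_monomial \<mu> e * exp (freq e * z))"

lemma finite_exponents: "finite (exponents L)"
  unfolding exponents_def using finite_A by (intro finite_PiE) auto

lemma card_exponents: "card (exponents L) = L ^ card A"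
  unfolding exponents_def using finite_A by (simp add: card_PiE)

lemma node_pos: "node e \<ge> 1"
proof -
  have "0 < node e" unfolding node_def using pos by (intro prod_pos) fastforce
  then show ?thesis by linarith
qed

lemma freq_eq: "freq e = (\<Sum>a\<in>A-{r}. gam e a * of_real (ln (real a)))"
proof -
  have "ln (real (node e)) = (\<Sum>a\<in>A. ln (real a ^ e a))"
    unfolding node_def of_nat_prod of_nat_power using pos finite_A by (intro ln_prod; fastforce)
  also have "\<dots> = (\<Sum>a\<in>A. real (e a) * ln (real a))"
    by (intro sum.cong refl ln_realpow)
  finally have "freq e = (\<Sum>a\<in>A. of_nat (e a) * of_real (ln (real a)))"
    by (simp add: freq_def)
  also have "\<dots> = of_nat (e r) * of_real (ln (real r)) + (\<Sum>a\<in>A-{r}. of_nat (e a) * of_real (ln (real a)))"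
    using finite_A r by (rule sum.remove)
  also have "\<dots> = (\<Sum>a\<in>A-{r}. gam e a * of_real (ln (real a)))"
    unfolding relation gam_def by (simp add: sum_distrib_left sum.distrib[symmetric] algebra_simps)
  finally show ?thesis .
qed

lemma exp_freq: "exp (freq e * of_nat l) = of_nat (node e ^ l)"
proof -
  have "exp (freq e * of_nat l) = exp (freq e) ^ l" by (metis exp_of_nat_mult mult.commute)
  also have "exp (freq e) = of_real (exp (ln (real (node e))))" unfolding freq_def by (simp only: exp_of_real)
  also have "exp (ln (real (node e))) = real (node e)" using node_pos[of e] by simp
  finally show ?thesis by simp
qed

lemma aux_eq_at_nat:
  "aux L p \<mu> (of_nat l) = (\<Sum>e\<in>exponents L. of_int (p e) * gam_monomial \<mu> e * of_nat (node e ^ l))"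
  unfolding aux_def exp_freq ..

lemma aux_holomorphic: "aux L p \<mu> holomorphic_on S"
  unfolding aux_def by (intro holomorphic_intros)

lemma higher_deriv_aux:
  "(deriv ^^ j) (aux L p \<mu>) z =
     (\<Sum>e\<in>exponents L. of_int (p e) * gam_monomial \<mu> e * freq e ^ j * exp (freq e * z))"
  unfolding aux_def[abs_def] higher_deriv_exp_sum ..

lemma gam_monomial_Suc:
  assumes "a \<in> A - {r}"
  shows "gam_monomial (\<mu>(a := Suc (\<mu> a))) e = gam e a * gam_monomial \<mu> e"
proof -
  have fin: "finite (A - {r})" using finite_A by simp
  have "(\<Prod>b\<in>A-{r}-{a}. gam e b ^ (\<mu>(a := Suc (\<mu> a))) b) = (\<Prod>b\<in>A-{r}-{a}. gam e b ^ \<mu> b)"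
    by (intro prod.cong) auto
  then show ?thesis
    unfolding gam_monomial_def
    by (simp only: prod.remove[OF fin assms] fun_upd_same power_Suc mult.assoc)
qed

lemma sum_fun_upd_Suc:
  assumes "a \<in> A - {r}"
  shows "sum (\<mu>(a := Suc (\<mu> a))) (A-{r}) = Suc (sum \<mu> (A-{r}))"
proof -
  have fin: "finite (A - {r})" using finite_A by simp
  have "sum (\<mu>(a := Suc (\<mu> a))) (A-{r}-{a}) = sum \<mu> (A-{r}-{a})" by (intro sum.cong) auto
  then show ?thesis using sum.remove[OF fin assms, of "\<mu>(a := Suc (\<mu> a))"] sum.remove[OF fin assms, of \<mu>] by simp
qed

lemma higher_deriv_aux_eq_0:
  assumes zero: "\<And>\<mu>. sum \<mu> (A-{r}) < S \<Longrightarrow> aux L p \<mu> z = 0"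
    and "sum \<mu> (A-{r}) + j < S"
  shows "(deriv ^^ j) (aux L p \<mu>) z = 0"
  using assms(2)
proof (induction j arbitrary: \<mu>)
  case 0
  then show ?case using zero by simp
next
  case (Suc j)
  have "(deriv ^^ Suc j) (aux L p \<mu>) z =
     (\<Sum>e\<in>exponents L. \<Sum>a\<in>A-{r}. of_real (ln (real a)) *
        (of_int (p e) * gam_monomial (\<mu>(a := Suc (\<mu> a))) e * freq e ^ j * exp (freq e * z)))"
    unfolding higher_deriv_aux
  proof (intro sum.cong refl)
    fix e
    have "of_int (p e) * gam_monomial \<mu> e * freq e ^ Suc j * exp (freq e * z) =
       freq e * (of_int (p e) * gam_monomial \<mu> e * freq e ^ j * exp (freq e * z))" by simp
    also have "\<dots> = (\<Sum>a\<in>A-{r}. of_real (ln (real a)) *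
        (of_int (p e) * gam_monomial (\<mu>(a := Suc (\<mu> a))) e * freq e ^ j * exp (freq e * z)))"
      unfolding freq_eq[of e] sum_distrib_right
      by (intro sum.cong refl) (simp add: gam_monomial_Suc freq_eq[of e])
    finally show "of_int (p e) * gam_monomial \<mu> e * freq e ^ Suc j * exp (freq e * z) = \<dots>" .
  qed
  also have "\<dots> = (\<Sum>a\<in>A-{r}. of_real (ln (real a)) * (deriv ^^ j) (aux L p (\<mu>(a := Suc (\<mu> a)))) z)"
    unfolding higher_deriv_aux by (subst sum.swap) (simp add: sum_distrib_left)
  also have "\<dots> = 0"
  proof (intro sum.neutral ballI)
    fix a assume "a \<in> A - {r}"
    then have "(deriv ^^ j) (aux L p (\<mu>(a := Suc (\<mu> a)))) z = 0"
      using Suc.prems sum_fun_upd_Suc[of a \<mu>] by (intro Suc.IH) linarith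
    then show "of_real (ln (real a)) * (deriv ^^ j) (aux L p (\<mu>(a := Suc (\<mu> a)))) z = 0" by simp
  qed
  finally show ?case .
qed

end

locale log_relation_bounds = log_relation +
  fixes I :: "'i set" and w :: "'i \<Rightarrow> complex" and i0 :: 'i and D :: int and C :: nat
  assumes finite_I: "finite I" and i0: "i0 \<in> I" "w i0 = 1" and D: "D \<noteq> 0" "\<bar>D\<bar> \<le> int C" and C: "C \<ge> 1"
    and norm_gam: "e \<in> exponents L \<Longrightarrow> a \<in> A - {r} \<Longrightarrow> norm (gam e a) \<le> real (C * L)"
    and acts_gam: "e \<in> exponents L \<Longrightarrow> a \<in> A - {r} \<Longrightarrow> acts_integrally I w (C * L) (of_int D * gam e a)"
    and node_le: "e \<in> exponents L \<Longrightarrow> node e \<le> C ^ L"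
begin

lemma norm_gam_monomial:
  assumes "e \<in> exponents L" "L \<ge> 1" "sum \<mu> (A-{r}) \<le> T"
  shows "norm (gam_monomial \<mu> e) \<le> real ((C * L) ^ T)"
proof -
  have "norm (gam_monomial \<mu> e) = (\<Prod>a\<in>A-{r}. norm (gam e a) ^ \<mu> a)"
    unfolding gam_monomial_def by (simp add: norm_power flip: prod_norm)
  also have "\<dots> \<le> (\<Prod>a\<in>A-{r}. real (C * L) ^ \<mu> a)"
    using norm_gam[OF assms(1)] by (intro prod_mono conjI power_mono) auto
  also have "\<dots> = real ((C * L) ^ sum \<mu> (A-{r}))" by (simp add: power_sum)
  also have "\<dots> \<le> real ((C * L) ^ T)"
    using C assms(2,3) by (intro of_nat_mono power_increasing) auto
  finally show ?thesis .
qed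

lemma norm_aux:
  assumes L: "L \<ge> 1" and \<mu>: "sum \<mu> (A-{r}) \<le> T" and z: "norm z \<le> real R"
    and p: "\<And>e. e \<in> exponents L \<Longrightarrow> \<bar>p e\<bar> \<le> int P"
  shows "norm (aux L p \<mu> z) \<le> real (L ^ card A * P * (C * L) ^ T * C ^ (L * R))"
proof -
  have "norm (of_int (p e) * gam_monomial \<mu> e * exp (freq e * z)) \<le>
      real P * real ((C * L) ^ T) * real (C ^ (L * R))" if e: "e \<in> exponents L" for e
  proof -
    have "\<bar>real_of_int (p e)\<bar> \<le> real P"
      using p[OF e] by (metis of_int_abs of_int_le_iff of_int_of_nat_eq)
    moreover have "norm (exp (freq e * z)) \<le> real (C ^ (L * R))"
    proof -
      have ln0: "0 \<le> ln (real (node e))" using node_pos[of e] by simp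
      have "ln (real (node e)) \<le> ln (real (C ^ L))"
        using node_le[OF e] node_pos[of e] by (intro ln_mono) (auto simp flip: of_nat_power)
      then have lnC: "ln (real (node e)) \<le> real L * ln (real C)" using C by (simp add: ln_realpow)
      have "norm (exp (freq e * z)) \<le> exp (norm (freq e * z))" by (rule norm_exp)
      also have "norm (freq e * z) = ln (real (node e)) * norm z"
        using ln0 by (simp add: freq_def norm_mult)
      also have "\<dots> \<le> (real L * ln (real C)) * real R"
        using lnC ln0 z C by (intro mult_mono) auto
      also have "exp \<dots> = real (C ^ (L * R))"
      proof -
        have "exp ((real L * ln (real C)) * real R) = exp (real (L * R) * ln (real C))"
          by (simp add: mult_ac)
        also have "\<dots> = exp (ln (real C)) ^ (L * R)" by (rule exp_of_nat_mult)
        finally show ?thesis using C by simp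
      qed
      finally show ?thesis by simp
    qed
    ultimately show ?thesis
      using norm_gam_monomial[OF e L \<mu>] unfolding norm_mult norm_of_int
      by (intro mult_mono) auto
  qed
  then have "norm (aux L p \<mu> z) \<le> (\<Sum>e\<in>exponents L. real P * real ((C * L) ^ T) * real (C ^ (L * R)))"
    unfolding aux_def by (intro order_trans[OF norm_sum] sum_mono)
  also have "\<dots> = real (L ^ card A * P * (C * L) ^ T * C ^ (L * R))"
    by (simp add: card_exponents)
  finally show ?thesis .
qed

lemma acts_integrally_term:
  assumes e: "e \<in> exponents L" and L: "L \<ge> 1" and \<mu>: "sum \<mu> (A-{r}) \<le> T" and l: "l \<le> R"
  shows "acts_integrally I w ((C * L) ^ T * C ^ (L * R))
    (of_int D ^ sum \<mu> (A-{r}) * gam_monomial \<mu> e * of_nat (node e ^ l))"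
proof -
  have "of_int D ^ sum \<mu> (A-{r}) * gam_monomial \<mu> e = (\<Prod>a\<in>A-{r}. (of_int D * gam e a) ^ \<mu> a)"
    unfolding gam_monomial_def power_sum by (simp add: power_mult_distrib prod.distrib)
  moreover have "acts_integrally I w (\<Prod>a\<in>A-{r}. (C * L) ^ \<mu> a) \<dots>"
    using acts_gam[OF e] by (intro acts_integrally_prod acts_integrally_power finite_I) auto
  moreover have "acts_integrally I w (node e ^ l) (of_nat (node e ^ l))"
    using acts_integrally_of_int[OF finite_I, of w "int (node e ^ l)"] by (simp add: nat_power_eq)
  ultimately have "acts_integrally I w ((\<Prod>a\<in>A-{r}. (C * L) ^ \<mu> a) * node e ^ l)
      (of_int D ^ sum \<mu> (A-{r}) * gam_monomial \<mu> e * of_nat (node e ^ l))"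
    by (simp only: acts_integrally_mult)
  moreover have "(\<Prod>a\<in>A-{r}. (C * L) ^ \<mu> a) \<le> (C * L) ^ T"
    unfolding power_sum[symmetric] using C L \<mu> by (intro power_increasing) auto
  moreover have "node e ^ l \<le> C ^ (L * R)"
  proof -
    have "node e ^ l \<le> (C ^ L) ^ l" using node_le[OF e] by (intro power_mono) auto
    also have "\<dots> \<le> (C ^ L) ^ R" using l C by (intro power_increasing) auto
    finally show ?thesis by (simp add: power_mult)
  qed
  ultimately show ?thesis by (meson acts_integrally_mono mult_le_mono)
qed

lemma acts_integrally_aux:
  assumes L: "L \<ge> 1" and \<mu>: "sum \<mu> (A-{r}) \<le> T" and l: "l \<le> R"
    and p: "\<And>e. e \<in> exponents L \<Longrightarrow> \<bar>p e\<bar> \<le> int P"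
  shows "acts_integrally I w (L ^ card A * P * (C * L) ^ T * C ^ (L * R))
    (of_int D ^ sum \<mu> (A-{r}) * aux L p \<mu> (of_nat l))"
proof -
  have "acts_integrally I w (\<Sum>e\<in>exponents L. P * ((C * L) ^ T * C ^ (L * R)))
    (\<Sum>e\<in>exponents L. of_int (p e) * (of_int D ^ sum \<mu> (A-{r}) * gam_monomial \<mu> e * of_nat (node e ^ l)))"
  proof (rule acts_integrally_sum[OF finite_I], rule acts_integrally_mult)
    fix e assume e: "e \<in> exponents L"
    then have "nat \<bar>p e\<bar> \<le> P" using p by fastforce
    then show "acts_integrally I w P (of_int (p e))"
      by (rule acts_integrally_mono[OF acts_integrally_of_int[OF finite_I]])
    show "acts_integrally I w ((C * L) ^ T * C ^ (L * R))
        (of_int D ^ sum \<mu> (A-{r}) * gam_monomial \<mu> e * of_nat (node e ^ l))"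
      by (rule acts_integrally_term[OF e L \<mu> l])
  qed
  also have "(\<Sum>e\<in>exponents L. of_int (p e) * (of_int D ^ sum \<mu> (A-{r}) * gam_monomial \<mu> e * of_nat (node e ^ l)))
     = of_int D ^ sum \<mu> (A-{r}) * aux L p \<mu> (of_nat l)"
    unfolding aux_eq_at_nat sum_distrib_left by (intro sum.cong refl) (simp only: mult_ac)
  also have "(\<Sum>e\<in>exponents L. P * ((C * L) ^ T * C ^ (L * R))) = L ^ card A * P * (C * L) ^ T * C ^ (L * R)"
    by (simp add: card_exponents)
  finally show ?thesis .
qed

text \<open>
  A value which is too small for Liouville's inequality must vanish.
\<close>

lemma extrapolation:
  assumes L: "L \<ge> 1" and q: "q \<ge> 2"
    and p: "\<And>e. e \<in> exponents L \<Longrightarrow> \<bar>p e\<bar> \<le> int P"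
    and zero: "\<And>\<mu> l. sum \<mu> (A-{r}) < S + t \<Longrightarrow> l < h \<Longrightarrow> aux L p \<mu> (of_nat l) = 0"
    and ST: "S \<le> T" and P: "P \<ge> 1"
    and small: "real (8 * card I ^ 2 * C ^ T *
      (L ^ card A * P * (C * L) ^ T * C ^ (L * (q^2*h))) ^ (2 * card I + 1)) * (2 / real q) ^ (h * t) < 1"
    and \<mu>: "sum \<mu> (A-{r}) < S" and l: "l < q * h"
  shows "aux L p \<mu> (of_nat l) = 0"
proof (rule ccontr)
  assume nz: "aux L p \<mu> (of_nat l) \<noteq> 0"
  define B where "B = L ^ card A * P * (C * L) ^ T * C ^ (L * (q^2*h))"
  define s where "s = sum \<mu> (A-{r})"
  have sT: "s \<le> T" using \<mu> ST by (simp add: s_def)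
  have B1: "B \<ge> 1" using L P C by (simp add: B_def)
  have h: "h \<ge> 1" using l by (cases h) auto
  have "q * h \<le> q^2 * h" using q by (simp add: power2_eq_square)
  then have lR: "l \<le> q^2 * h" using l by linarith
  have "1 \<le> norm (of_int D ^ s * aux L p \<mu> (of_nat l)) * real (8 * card I ^ 2 * B ^ (2 * card I))"
    using acts_integrally_aux[OF L sT[unfolded s_def] lR p] nz D B1 unfolding B_def[symmetric] s_def
    by (intro liouville[where w = w, OF finite_I i0]) auto
  moreover have "norm (of_int D ^ s * aux L p \<mu> (of_nat l)) \<le> real (C ^ T) * (real B * (2 / real q) ^ (h * t))"
    unfolding norm_mult
  proof (intro mult_mono)
    have "real_of_int \<bar>D\<bar> \<le> real C" using D(2) by linarith
    then have "norm (of_int D ^ s :: complex) \<le> real C ^ s"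
      unfolding norm_power by (intro power_mono) auto
    also have "\<dots> \<le> real C ^ T" using C sT by (intro power_increasing) auto
    finally show "norm (of_int D ^ s :: complex) \<le> real (C ^ T)" by simp
    have "norm (aux L p \<mu> (of_nat l)) \<le> real B * (real (q * h) / (real (q^2*h) / 2)) ^ (h * t)"
    proof (rule norm_le_of_many_zeros[where f = "aux L p \<mu>" and y = "of_nat l" and R = "real (q^2*h)"])
      show "(deriv ^^ j) (aux L p \<mu>) (of_nat m) = 0" if "m < h" "j < t" for m j
        using higher_deriv_aux_eq_0[of "S + t" L p "of_nat m" \<mu> j] zero that \<mu> by simp
      show "norm (aux L p \<mu> z) \<le> real B" if "norm z = real (q^2*h)" for z
        unfolding B_def using that by (intro norm_aux L p sT[unfolded s_def]) auto
      show "norm (complex_of_nat l) \<le> real (q^2*h)" using lR by (simp only: norm_of_nat of_nat_le_iff)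
      show "norm (complex_of_nat l - of_nat m) \<le> real (q * h)" if "m < h" for m
      proof -
        have "1 * h \<le> q * h" using q by (intro mult_le_mono) auto
        then have "m < q * h" using that by linarith
        then have "\<bar>real l - real m\<bar> \<le> real (q * h)" using l by linarith
        moreover have "norm (complex_of_nat l - of_nat m) = \<bar>real l - real m\<bar>"
          by (metis norm_of_real of_real_diff of_real_of_nat_eq)
        ultimately show ?thesis by simp
      qed
      show "0 < real (q^2*h) / 2" using q h by simp
      have "2 ^ 2 * h \<le> q^2 * h" using q by (intro mult_le_mono power_mono) auto
      then have "2 * h \<le> q^2 * h" unfolding power2_eq_square by linarith
      then have "2 * real h \<le> real (q^2*h)" by linarith
      then show "real h + real (q^2*h) / 2 \<le> real (q^2*h)" by linarith
    qed (rule aux_holomorphic)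
    also have "real (q * h) / (real (q^2*h) / 2) = 2 / real q"
      using q h by (simp add: field_simps power2_eq_square)
    finally show "norm (aux L p \<mu> (of_nat l)) \<le> real B * (2 / real q) ^ (h * t)" .
  qed auto
  ultimately have "1 \<le> real (C ^ T) * (real B * (2 / real q) ^ (h * t)) * real (8 * card I ^ 2 * B ^ (2 * card I))"
    by (meson mult_right_mono of_nat_0_le_iff order_trans)
  also have "\<dots> = real (8 * card I ^ 2 * C ^ T * B ^ (2 * card I + 1)) * (2 / real q) ^ (h * t)"
    by (simp add: mult_ac)
  finally show False using small unfolding B_def[symmetric] by linarith
qed

lemma initial_zeros:
  assumes L: "L \<ge> 1" and count: "2 * (T ^ (card A - 1) * q * card I) \<le> L ^ card A"
  defines "P \<equiv> 2 * L ^ card A * ((C * L) ^ T * C ^ (L * q))"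
  shows "\<exists>p. (\<forall>\<mu> l. sum \<mu> (A-{r}) < T \<longrightarrow> l < q \<longrightarrow> aux L p \<mu> (of_nat l) = 0) \<and>
    (\<forall>e\<in>exponents L. \<bar>p e\<bar> \<le> int P) \<and> (\<exists>e\<in>exponents L. p e \<noteq> 0)"
proof -
  define M where "M = {\<mu> \<in> PiE (A-{r}) (\<lambda>_. {..<T}). sum \<mu> (A-{r}) < T}"
  define E where "E = M \<times> {..<q} \<times> I"
  define val where "val = (\<lambda>\<mu> l e. of_int D ^ sum \<mu> (A-{r}) * gam_monomial \<mu> e * of_nat (node e ^ l))"
  define c where "c = (\<lambda>\<mu> l e. SOME c. val \<mu> l e = (\<Sum>j\<in>I. of_int (c j) * w j) \<and>
    (\<forall>j\<in>I. \<bar>c j\<bar> \<le> int ((C * L) ^ T * C ^ (L * q))))"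
  have c: "val \<mu> l e = (\<Sum>j\<in>I. of_int (c \<mu> l e j) * w j) \<and> (\<forall>j\<in>I. \<bar>c \<mu> l e j\<bar> \<le> int ((C * L) ^ T * C ^ (L * q)))"
    if "\<mu> \<in> M" "l < q" "e \<in> exponents L" for \<mu> l e
  proof -
    have "acts_integrally I w ((C * L) ^ T * C ^ (L * q)) (val \<mu> l e)"
      unfolding val_def using that by (intro acts_integrally_term L) (auto simp: M_def)
    from acts_integrally_coords[where w = w, OF finite_I i0 this]
    show ?thesis unfolding c_def by (rule someI_ex)
  qed
  have finM: "finite (PiE (A-{r}) (\<lambda>_. {..<T}))" using finite_A by (intro finite_PiE) auto
  then have "finite M" unfolding M_def by simp
  then have finE: "finite E" unfolding E_def using finite_I by simp
  have "card M \<le> card (PiE (A-{r}) (\<lambda>_. {..<T}))" unfolding M_def using finM by (intro card_mono) auto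
  also have "\<dots> = T ^ (card A - 1)" using finite_A r by (simp add: card_PiE)
  finally have "card E \<le> T ^ (card A - 1) * (q * card I)"
    unfolding E_def card_cartesian_product card_lessThan by (intro mult_le_mono) auto
  then have "2 * card E \<le> card (exponents L)" using count by (simp add: card_exponents mult_ac)
  moreover have "(\<lambda>a\<in>A. 0) \<in> exponents L" using L by (auto simp: exponents_def)
  then have "exponents L \<noteq> {}" by blast
  moreover have "1 \<le> (C * L) ^ T * C ^ (L * q)" using C L by simp
  moreover have "\<bar>(\<lambda>(\<mu>, l, j) e. c \<mu> l e j) x e\<bar> \<le> int ((C * L) ^ T * C ^ (L * q))"
    if "x \<in> E" "e \<in> exponents L" for x e using that c by (auto simp: E_def)
  ultimately have "\<exists>p. (\<forall>x\<in>E. (\<Sum>e\<in>exponents L. (\<lambda>(\<mu>, l, j) e. c \<mu> l e j) x e * p e) = 0) \<and>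
     (\<forall>e\<in>exponents L. \<bar>p e\<bar> \<le> int (2 * card (exponents L) * ((C * L) ^ T * C ^ (L * q)))) \<and>
     (\<exists>e\<in>exponents L. p e \<noteq> 0)"
    by (intro siegel finE finite_exponents)
  then obtain p where p: "\<forall>x\<in>E. (\<Sum>e\<in>exponents L. (\<lambda>(\<mu>, l, j) e. c \<mu> l e j) x e * p e) = 0"
     "\<forall>e\<in>exponents L. \<bar>p e\<bar> \<le> int (2 * card (exponents L) * ((C * L) ^ T * C ^ (L * q)))"
     "\<exists>e\<in>exponents L. p e \<noteq> 0" by (elim exE conjE)
  have "aux L p \<mu> (of_nat l) = 0" if \<mu>: "sum \<mu> (A-{r}) < T" and l: "l < q" for \<mu> l
  proof -
    define \<nu> where "\<nu> = restrict \<mu> (A-{r})"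
    have sum\<nu>: "sum \<nu> (A-{r}) = sum \<mu> (A-{r})" by (simp add: \<nu>_def)
    have "\<mu> a < T" if "a \<in> A - {r}" for a
      using member_le_sum[OF that, of \<mu>] finite_A \<mu> by simp
    then have \<nu>: "\<nu> \<in> M" unfolding M_def using \<mu> sum\<nu> by (auto simp: \<nu>_def)
    have "gam_monomial \<nu> e = gam_monomial \<mu> e" for e by (simp add: gam_monomial_def \<nu>_def)
    then have "of_int D ^ sum \<mu> (A-{r}) * aux L p \<mu> (of_nat l) = (\<Sum>e\<in>exponents L. of_int (p e) * val \<nu> l e)"
      unfolding aux_eq_at_nat sum_distrib_left val_def sum\<nu> by (intro sum.cong refl) (simp only: mult_ac)
    also have "\<dots> = (\<Sum>e\<in>exponents L. \<Sum>j\<in>I. of_int (c \<nu> l e j * p e) * w j)"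
    proof (rule sum.cong[OF refl])
      fix e assume "e \<in> exponents L"
      then have "val \<nu> l e = (\<Sum>j\<in>I. of_int (c \<nu> l e j) * w j)" using c[OF \<nu> l] by blast
      then show "of_int (p e) * val \<nu> l e = (\<Sum>j\<in>I. of_int (c \<nu> l e j * p e) * w j)"
        by (simp add: sum_distrib_left mult_ac)
    qed
    also have "\<dots> = (\<Sum>j\<in>I. of_int (\<Sum>e\<in>exponents L. c \<nu> l e j * p e) * w j)"
      by (subst sum.swap) (simp add: sum_distrib_right)
    also have "\<dots> = 0"
    proof (intro sum.neutral ballI)
      fix j assume "j \<in> I"
      then have "(\<nu>, l, j) \<in> E" using \<nu> l by (simp add: E_def)
      from bspec[OF p(1) this] show "of_int (\<Sum>e\<in>exponents L. c \<nu> l e j * p e) * w j = 0" by simp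
    qed
    finally show ?thesis using D by simp
  qed
  then show ?thesis using p(2,3) unfolding P_def card_exponents by (intro exI[of _ p]) simp
qed

lemma bounds_contradictory: False
proof -
  define n where "n = card A"
  define d where "d = card I"
  define K where "K = 3 * n^2"
  have n: "n \<ge> 1" unfolding n_def using finite_A r by (metis One_nat_def Suc_leI card_gt_0_iff empty_iff)
  have K: "K \<ge> 1" using n by (simp add: K_def)
  have "eventually (\<lambda>q. real ((8 * d^2 + 1) * C ^ K * (2 * C ^ (2*K+2)) ^ (2*d+1)) *
      real q ^ ((6*n^2 + 6*n*K) * (2*d+1)) * (2 / real q) ^ q < 1 \<and> q \<ge> 2 + 2 * d * K ^ (n-1)) at_top"
    by (intro eventually_conj eventually_power_decay eventually_ge_at_top)
  then obtain q where small: "real ((8 * d^2 + 1) * C ^ K * (2 * C ^ (2*K+2)) ^ (2*d+1)) *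
      real q ^ ((6*n^2 + 6*n*K) * (2*d+1)) * (2 / real q) ^ q < 1" and q: "q \<ge> 2 + 2 * d * K ^ (n-1)"
    by (auto dest: eventually_happens)
  define t where "t = q ^ (3*n+2)"
  define L where "L = q ^ (3*n-1)"
  define T where "T = K * t"
  define P where "P = 2 * L ^ n * ((C * L) ^ T * C ^ (L * q))"
  have q2: "q \<ge> 2" using q by simp
  have L: "L \<ge> 1" using q2 by (simp add: L_def)
  have P1: "P \<ge> 1" using L C by (simp add: P_def)
  obtain m where m: "n = Suc m" using n by (cases n) auto
  have Ln: "L ^ n = q ^ (3*n^2 - n)"
    by (simp add: L_def diff_mult_distrib power2_eq_square mult.assoc flip: power_mult)
  have "2 * (T ^ (n - 1) * q * d) = (2 * d * K ^ (n-1)) * (q ^ ((3*n+2)*(n-1)) * q)"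
    unfolding T_def t_def power_mult_distrib power_mult[symmetric] by (simp only: mult_ac)
  also have "\<dots> \<le> q * (q ^ ((3*n+2)*(n-1)) * q)" using q by (intro mult_le_mono1) simp
  also have "\<dots> = q ^ ((3*n+2)*(n-1) + 2)" by (simp add: power_add power2_eq_square mult_ac)
  also have "(3*n+2)*(n-1) + 2 = 3*n^2 - n" by (simp add: m power2_eq_square algebra_simps)
  finally have "2 * (T ^ (n - 1) * q * d) \<le> L ^ n" unfolding Ln .
  then have count: "2 * (T ^ (card A - 1) * q * card I) \<le> L ^ card A"
    unfolding n_def d_def .
  obtain p where p0: "\<forall>\<mu> l. sum \<mu> (A-{r}) < T \<longrightarrow> l < q \<longrightarrow> aux L p \<mu> (of_nat l) = 0"
    and pP: "\<forall>e\<in>exponents L. \<bar>p e\<bar> \<le> int P" and pnz: "\<exists>e\<in>exponents L. p e \<noteq> 0"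
    using initial_zeros[OF L count] unfolding P_def n_def by blast
  have zeros: "\<forall>\<mu> l. sum \<mu> (A-{r}) < (K - J) * t \<longrightarrow> l < q ^ (J+1) \<longrightarrow> aux L p \<mu> (of_nat l) = 0"
    if "J < K" for J using that
  proof (induction J)
    case 0
    then show ?case using p0 by (simp add: T_def)
  next
    case (Suc J)
    show ?case
    proof (intro allI impI)
      fix \<mu> l assume \<mu>: "sum \<mu> (A-{r}) < (K - Suc J) * t" and l: "l < q ^ (Suc J + 1)"
      have "K - J = Suc (K - Suc J)" using Suc.prems by simp
      then have Kt: "(K - J) * t = (K - Suc J) * t + t" by simp
      have zero: "aux L p \<mu> (of_nat l) = 0" if "sum \<mu> (A-{r}) < (K - Suc J) * t + t" "l < q ^ (J+1)" for \<mu> l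
        using Suc.IH Suc.prems that unfolding Kt by simp
      have ST: "(K - Suc J) * t \<le> T" unfolding T_def by (intro mult_le_mono1) simp
      have q1: "q \<ge> 1" using q2 by simp
      have small': "real (8 * card I ^ 2 * C ^ T *
          (L ^ card A * P * (C * L) ^ T * C ^ (L * (q^2 * q ^ (J+1)))) ^ (2 * card I + 1)) *
          (2 / real q) ^ (q ^ (J+1) * t) < 1"
        using auxiliary_parameters_bound[OF q1 C n small, of J]
        by (simp only: T_def t_def L_def P_def n_def d_def)
      have "l < q * q ^ (J+1)" using l by simp
      from extrapolation[OF L q2 _ zero ST P1 small' \<mu> this] pP
      show "aux L p \<mu> (of_nat l) = 0" by blast
    qed
  qed
  have vanish: "(\<Sum>e\<in>exponents L. of_int (p e) * of_nat (node e) ^ l) = (0::complex)" if l: "l < L ^ n" for l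
  proof -
    have "L ^ n \<le> q ^ K" unfolding Ln K_def using q2 by (intro power_increasing) auto
    then have "l < q ^ (K - 1 + 1)" using l K by simp
    moreover have "0 < t" using q2 by (simp add: t_def)
    ultimately have "aux L p (\<lambda>_. 0) (of_nat l) = 0"
      using zeros[of "K - 1"] K by simp
    then show ?thesis by (simp add: aux_eq_at_nat gam_monomial_def)
  qed
  have "inj_on node (exponents L)"
    unfolding node_def[abs_def] by (rule inj_on_subset[OF indep]) (auto simp: exponents_def)
  then have inj: "inj_on (\<lambda>e. complex_of_nat (node e)) (exponents L)"
    by (auto simp: inj_on_def)
  obtain e where e: "e \<in> exponents L" "p e \<noteq> 0" using pnz by blast
  have "complex_of_int (p e) = 0"
    using vanish by (intro vanishing_power_sums[OF finite_exponents inj _ e(1), of "\<lambda>e. of_int (p e)"])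
      (simp add: card_exponents n_def)
  then show False using e by simp
qed

end

lemma (in log_relation) no_log_relation: False
proof -
  have "finite (A - {r})" using finite_A by simp
  from common_integral_action[OF this, of \<beta>] alg
  obtain I :: "(nat \<Rightarrow> nat) set" and w i and D :: int and B where I: "finite I" "i \<in> I" "w i = 1" and D: "D \<noteq> 0"
    and B: "\<forall>a\<in>A-{r}. acts_integrally I w B (of_int D * \<beta> a)"
    by auto
  define Q where "Q = (\<Prod>a\<in>A. a)"
  define X where "X = (\<Sum>a\<in>A-{r}. nat \<lceil>norm (\<beta> a)\<rceil>)"
  define C where "C = nat \<bar>D\<bar> + B + X + 1 + Q"
  have lt: "e a < L" if "e \<in> exponents L" "a \<in> A" for e a L
    using that by (auto simp: exponents_def PiE_iff)
  interpret log_relation_bounds A r \<beta> I w i D C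
  proof unfold_locales
    show "norm (gam e a) \<le> real (C * L)" if e: "e \<in> exponents L" and a: "a \<in> A - {r}" for e a L
    proof -
      have "nat \<lceil>norm (\<beta> a)\<rceil> \<le> X"
        unfolding X_def using finite_A a by (intro member_le_sum) auto
      then have \<beta>: "1 + norm (\<beta> a) \<le> real C" unfolding C_def by linarith
      have "norm (gam e a) \<le> real (e a) + real (e r) * norm (\<beta> a)"
        unfolding gam_def by (rule order_trans[OF norm_triangle_ineq]) (simp add: norm_mult)
      also have "\<dots> \<le> real L + real L * norm (\<beta> a)"
        using lt[OF e, of a] lt[OF e r] a by (intro add_mono mult_right_mono) auto
      also have "\<dots> = real L * (1 + norm (\<beta> a))" by (simp add: distrib_left)
      also have "\<dots> \<le> real L * real C" using \<beta> by (intro mult_left_mono) auto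
      finally show ?thesis by (simp add: mult.commute)
    qed
    show "acts_integrally I w (C * L) (of_int D * gam e a)" if e: "e \<in> exponents L" and a: "a \<in> A - {r}" for e a L
    proof -
      have "of_int D * gam e a = of_int (D * int (e a)) + of_int (int (e r)) * (of_int D * \<beta> a)"
        by (simp add: gam_def algebra_simps)
      moreover have "acts_integrally I w (nat \<bar>D * int (e a)\<bar> + nat \<bar>int (e r)\<bar> * B) \<dots>"
        using B a by (intro acts_integrally_add acts_integrally_mult acts_integrally_of_int I) auto
      moreover have "nat \<bar>D * int (e a)\<bar> + nat \<bar>int (e r)\<bar> * B \<le> C * L"
      proof -
        have "nat \<bar>D * int (e a)\<bar> + nat \<bar>int (e r)\<bar> * B = nat \<bar>D\<bar> * e a + e r * B"
          by (simp add: abs_mult nat_mult_distrib)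
        also have "\<dots> \<le> nat \<bar>D\<bar> * L + L * B"
          using lt[OF e, of a] lt[OF e r] a by (intro add_mono mult_le_mono) auto
        also have "\<dots> \<le> C * L" by (simp add: C_def algebra_simps)
        finally show ?thesis .
      qed
      ultimately show ?thesis by (metis acts_integrally_mono)
    qed
    show "node e \<le> C ^ L" if e: "e \<in> exponents L" for e L
    proof -
      have "node e \<le> (\<Prod>a\<in>A. a ^ L)"
        unfolding node_def
      proof (intro prod_mono conjI)
        fix a assume "a \<in> A"
        then show "a ^ e a \<le> a ^ L" using pos lt[OF e, of a] by (intro power_increasing) auto
      qed simp
      also have "\<dots> = Q ^ L" by (simp add: Q_def prod_power_distrib)
      also have "\<dots> \<le> C ^ L" by (intro power_mono) (simp_all add: C_def)
      finally show ?thesis .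
    qed
  qed (use I D in \<open>auto simp: C_def\<close>)
  show False by (rule bounds_contradictory)
qed

lemma baker_integers:
  fixes \<beta> :: "nat \<Rightarrow> complex"
  assumes A: "finite A" "\<And>a. a \<in> A \<Longrightarrow> a \<ge> 1"
    and indep: "inj_on (\<lambda>e. \<Prod>a\<in>A. a ^ e a) (PiE A (\<lambda>_. UNIV))"
    and alg: "\<And>a. a \<in> A \<Longrightarrow> algebraic (\<beta> a)"
    and zero: "(\<Sum>a\<in>A. \<beta> a * of_real (ln (real a))) = 0"
    and b: "b \<in> A"
  shows "\<beta> b = 0"
proof (rule ccontr)
  assume nz: "\<beta> b \<noteq> 0"
  have "\<beta> b * of_real (ln (real b)) = - (\<Sum>a\<in>A-{b}. \<beta> a * of_real (ln (real a)))"
    using zero sum.remove[OF A(1) b, of "\<lambda>a. \<beta> a * of_real (ln (real a))"]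
    by (simp add: eq_neg_iff_add_eq_0)
  then have "of_real (ln (real b)) = - (\<Sum>a\<in>A-{b}. \<beta> a * of_real (ln (real a))) / \<beta> b"
    using nz by (simp add: field_simps)
  also have "\<dots> = (\<Sum>a\<in>A-{b}. - \<beta> a / \<beta> b * of_real (ln (real a)))"
    by (simp add: sum_divide_distrib sum_negf)
  finally have rel: "of_real (ln (real b)) = (\<Sum>a\<in>A-{b}. - \<beta> a / \<beta> b * of_real (ln (real a)))" .
  have "algebraic (- \<beta> a / \<beta> b)" if "a \<in> A - {b}" for a
    unfolding divide_inverse using alg that b
    by (intro algebraic_add_mult(2) algebraic_minus algebraic_inverse) auto
  then interpret log_relation A b "\<lambda>a. - \<beta> a / \<beta> b"
    using A b indep rel by unfold_locales auto
  show False by (rule no_log_relation)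
qed

lemma multiplicity_prod_power_property_A:
  fixes J :: "nat set"
  assumes J: "finite J" and pos: "\<And>a. a \<in> J \<Longrightarrow> a \<ge> 1" and p: "prime p" and b: "b \<in> J"
    and other: "\<And>a. a \<in> J \<Longrightarrow> a \<noteq> b \<Longrightarrow> \<not> p dvd a"
  shows "multiplicity p (\<Prod>a\<in>J. a ^ e a) = e b * multiplicity p b"
proof -
  have nz: "a \<noteq> 0" if "a \<in> J" for a using pos[OF that] by simp
  have "multiplicity p (\<Prod>a\<in>J. a ^ e a) = (\<Sum>a\<in>J. multiplicity p (a ^ e a))"
    using J p by (intro prime_elem_multiplicity_prod_distrib) (auto dest: nz)
  also have "\<dots> = (\<Sum>a\<in>J. e a * multiplicity p a)"
    using p by (intro sum.cong refl prime_elem_multiplicity_power_distrib) (auto dest: nz)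
  also have "\<dots> = (\<Sum>a\<in>{b}. e a * multiplicity p a)"
    using J b other by (intro sum.mono_neutral_right) (auto simp: not_dvd_imp_multiplicity_0)
  finally show ?thesis by simp
qed

lemma property_A_imp_multiplicatively_independent:
  fixes J :: "nat set"
  assumes J: "finite J" and pos: "\<And>a. a \<in> J \<Longrightarrow> a \<ge> 1" and A: "property_A (int ` J)"
  shows "inj_on (\<lambda>e. \<Prod>a\<in>J. a ^ e a) (PiE J (\<lambda>_. UNIV))"
proof (rule inj_onI)
  fix e e' assume e: "e \<in> PiE J (\<lambda>_. UNIV)" "e' \<in> PiE J (\<lambda>_. UNIV)"
    and eq: "(\<Prod>a\<in>J. a ^ e a) = (\<Prod>a\<in>J. a ^ e' a)"
  show "e = e'"
  proof (rule PiE_ext[OF e])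
    fix b assume b: "b \<in> J"
    then obtain p' :: int where p': "prime p'" "p' dvd int b" "\<forall>a\<in>J. a \<noteq> b \<longrightarrow> \<not> p' dvd int a"
      using A unfolding property_A_def by auto
    define p where "p = nat p'"
    have pp: "p' = int p" using p'(1) by (simp add: p_def prime_ge_0_int)
    have p: "prime p" "p dvd b" "\<And>a. a \<in> J \<Longrightarrow> a \<noteq> b \<Longrightarrow> \<not> p dvd a"
      using p' unfolding pp by auto
    have "e b * multiplicity p b = e' b * multiplicity p b"
      using multiplicity_prod_power_property_A[OF J pos p(1) b p(3)] eq by metis
    moreover have "multiplicity p b > 0"
      using p pos[OF b] by (subst prime_multiplicity_gt_zero_iff) auto
    ultimately show "e b = e' b" by simp
  qed
qed

lemma qbar_independent_logs:
  fixes J :: "nat set"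
  assumes J: "finite J" and pos: "\<And>a. a \<in> J \<Longrightarrow> a \<ge> 1"
    and indep: "inj_on (\<lambda>e. \<Prod>a\<in>J. a ^ e a) (PiE J (\<lambda>_. UNIV))"
  defines "l \<equiv> \<lambda>a. complex_of_real (ln (real a))"
  shows "inj_on l J" "qbar_complex.independent (l ` J)"
proof -
  show inj: "inj_on l J"
  proof (rule inj_onI)
    fix a b assume ab: "a \<in> J" "b \<in> J" "l a = l b"
    then have "ln (real a) = ln (real b)" by (simp add: l_def)
    then show "a = b" using pos[OF ab(1)] pos[OF ab(2)] by (subst (asm) ln_inj_iff) auto
  qed
  show "qbar_complex.independent (l ` J)"
  proof
    assume "qbar_complex.dependent (l ` J)"
    then obtain u where u: "\<exists>v\<in>l ` J. u v \<noteq> 0" "(\<Sum>v\<in>l ` J. complex_of_qbar (u v) * v) = 0"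
      using J by (subst (asm) qbar_complex.dependent_finite) auto
    then obtain b where b: "b \<in> J" "u (l b) \<noteq> 0" by auto
    have "(\<Sum>a\<in>J. complex_of_qbar (u (l a)) * complex_of_real (ln (real a))) = 0"
      using u(2) unfolding sum.reindex[OF inj] by (simp add: l_def)
    then have "complex_of_qbar (u (l b)) = 0"
      by (intro baker_integers[OF J pos indep _ _ b(1), where \<beta> = "\<lambda>a. complex_of_qbar (u (l a))"]
          algebraic_complex_of_qbar)
    then show False using b(2) by (metis complex_of_qbar_inject complex_of_qbar_simps(1))
  qed
qed

lemma qbar_dim_translated:
  fixes S :: "complex set" and c :: complex
  assumes S: "finite S" "qbar_complex.independent S"
  shows "card S - 1 \<le> qbar_dim ((\<lambda>x. c - x) ` S)"
proof -
  obtain B where B: "B \<subseteq> (\<lambda>x. c - x) ` S" "(\<lambda>x. c - x) ` S \<subseteq> qbar_complex.span B"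
    "card B = qbar_dim ((\<lambda>x. c - x) ` S)"
    using qbar_complex.basis_exists[of "(\<lambda>x. c - x) ` S"] unfolding qbar_dim_def by metis
  have finB: "finite (insert c B)" using B(1) S(1) by (meson finite.insertI finite_imageI finite_subset)
  have "S \<subseteq> qbar_complex.span (insert c B)"
  proof
    fix x assume "x \<in> S"
    then have "c - x \<in> qbar_complex.span (insert c B)"
      using B(2) qbar_complex.span_mono[of B "insert c B"] by blast
    moreover have "c \<in> qbar_complex.span (insert c B)" by (intro qbar_complex.span_base) simp
    ultimately have "c - (c - x) \<in> qbar_complex.span (insert c B)" by (rule qbar_complex.span_diff[rotated])
    then show "x \<in> qbar_complex.span (insert c B)" by simp
  qed
  then have "card S \<le> card (insert c B)"
    using qbar_complex.independent_span_bound[OF finB S(2)] by blast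
  also have "\<dots> \<le> card B + 1" using finB by (simp add: card_insert_if)
  finally show ?thesis using B(3) by simp
qed

section \<open>The functional equation\<close>

lemma nicely_meromorphic_eqI:
  assumes f: "f nicely_meromorphic_on UNIV" and g: "g nicely_meromorphic_on UNIV"
    and U: "open U" "U \<noteq> {}" and eq: "\<And>s. s \<in> U \<Longrightarrow> f s = g s"
  shows "f = g"
proof
  fix z
  have mero: "(\<lambda>s. f s - g s) meromorphic_on UNIV"
    using f g by (intro meromorphic_on_diff) (auto simp: nicely_meromorphic_on_def)
  obtain a where a: "a \<in> U" using U by blast
  have "eventually (\<lambda>s. s \<in> U) (at a)"
    using U(1) a by (intro eventually_at_in_open')
  then have ev0: "eventually (\<lambda>s. f s - g s = 0) (at a)"
    by eventually_elim (simp add: eq)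
  have "\<not> eventually (\<lambda>s. f s - g s \<noteq> 0) (cosparse UNIV)"
  proof
    assume "eventually (\<lambda>s. f s - g s \<noteq> 0) (cosparse UNIV)"
    then have "eventually (\<lambda>s. f s - g s \<noteq> 0) (at a)"
      by (rule eventually_cosparse_imp_eventually_at) simp
    with ev0 have "eventually (\<lambda>s. False) (at a)" by eventually_elim simp
    then show False by simp
  qed
  then have "eventually (\<lambda>s. f s - g s = 0) (cosparse UNIV)"
    using meromorphic_imp_constant_or_avoid[OF mero, of 0] by auto
  then have "eventually (\<lambda>s. f s - g s = 0) (at z)"
    by (rule eventually_cosparse_imp_eventually_at) simp
  then have ev: "eventually (\<lambda>s. f s = g s) (at z)" by eventually_elim simp
  have disj: "is_pole h z \<and> h z = 0 \<or> h \<midarrow>z\<rightarrow> h z" if "h nicely_meromorphic_on UNIV" for h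
    using that by (auto simp: nicely_meromorphic_on_def)
  have pole: "is_pole f z \<longleftrightarrow> is_pole g z" using ev by (intro is_pole_cong) auto
  have lim: "f \<midarrow>z\<rightarrow> c \<longleftrightarrow> g \<midarrow>z\<rightarrow> c" for c using ev by (intro tendsto_cong)
  have not_both: "\<not> (is_pole g z \<and> g \<midarrow>z\<rightarrow> c)" for c
    using not_tendsto_and_filterlim_at_infinity[of "at z" g c] by (auto simp: is_pole_def)
  show "f z = g z"
  proof (cases "is_pole g z")
    case True
    then show ?thesis using disj[OF f] disj[OF g] lim[of "f z"] not_both[of "f z"] not_both[of "g z"] pole by auto
  next
    case False
    then have "g \<midarrow>z\<rightarrow> f z" "g \<midarrow>z\<rightarrow> g z" using disj[OF f] disj[OF g] lim[of "f z"] pole by auto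
    then show ?thesis by (rule LIM_unique)
  qed
qed

lemma is_L_function_unique:
  assumes "is_L_function f L" "is_L_function f M"
  shows "L = M"
proof (rule nicely_meromorphic_eqI)
  show "L s = M s" if "s \<in> {s. 1 < Re s}" for s
  proof -
    have "(\<lambda>n. Hecke_eigenvalue f (Suc n) * of_nat (Suc n) powr - s) sums L s"
      "(\<lambda>n. Hecke_eigenvalue f (Suc n) * of_nat (Suc n) powr - s) sums M s"
      using assms that by (simp_all add: is_L_function_def del: of_nat_Suc)
    then show ?thesis by (rule sums_unique2)
  qed
  have "2 \<in> {s. 1 < Re s}" by simp
  then show "{s. 1 < Re s} \<noteq> {}" by blast
qed (use assms in \<open>auto simp: is_L_function_def open_halfspace_Re_gt\<close>)

lemma is_L_function_L_function:
  assumes "is_L_function f L"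
  shows "is_L_function f (L_function f)"
  unfolding L_function_def by (rule theI[where P = "is_L_function f", OF assms]) (rule is_L_function_unique[OF _ assms])

lemma nicely_meromorphic_nonzero_imp_analytic:
  assumes "f nicely_meromorphic_on UNIV" "f z \<noteq> 0"
  shows "f analytic_on {z}"
proof (rule nicely_meromorphic_on_imp_analytic_at[OF assms(1)])
  have "f \<midarrow>z\<rightarrow> f z" using assms by (auto simp: nicely_meromorphic_on_def)
  then show "\<not> is_pole f z"
    using not_tendsto_and_filterlim_at_infinity[of "at z" f "f z"] by (auto simp: is_pole_def)
qed simp

lemma L_function_dual_form:
  assumes "self_dual f"
  shows "L_function (dual_form f) = L_function f"
  using assms unfolding L_function_def is_L_function_def self_dual_def by simp

lemma conductor_dual_form:
  assumes "self_dual f"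
  shows "conductor (dual_form f) = conductor f"
proof -
  have "level (dual_form f) = level f" by (simp add: dual_form_def)
  then show ?thesis using assms unfolding conductor_def self_dual_def by simp
qed

definition gamma_factor :: "nat \<Rightarrow> complex multiset \<Rightarrow> complex \<Rightarrow> complex" where
  "gamma_factor d \<kappa> s = of_real pi powr (- of_nat d * s / 2) * (\<Prod>k\<in>#\<kappa>. Gamma ((s + k) / 2))"

lemma gamma_factor_analytic:
  assumes "\<And>k. k \<in># \<kappa> \<Longrightarrow> (s + k) / 2 \<notin> \<int>\<^sub>\<le>\<^sub>0"
  shows "gamma_factor d \<kappa> analytic_on {s}" "gamma_factor d \<kappa> s \<noteq> 0"
proof -
  have "(\<lambda>s. \<Prod>k\<in>#\<kappa>. Gamma ((s + k) / 2)) analytic_on {s} \<and> (\<Prod>k\<in>#\<kappa>. Gamma ((s + k) / 2)) \<noteq> 0"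
    using assms
  proof (induction \<kappa>)
    case (add k \<kappa>)
    have "(\<lambda>s. Gamma ((s + k) / 2)) analytic_on {s}"
      using add.prems[of k] by (intro analytic_intros) auto
    moreover have "Gamma ((s + k) / 2) \<noteq> 0" using add.prems[of k] by (intro Gamma_nonzero) simp
    ultimately show ?case using add by (auto intro!: analytic_intros)
  qed auto
  then show "gamma_factor d \<kappa> analytic_on {s}" "gamma_factor d \<kappa> s \<noteq> 0"
    unfolding gamma_factor_def[abs_def] by (auto intro!: analytic_intros simp: iffD2[OF not_le pi_gt_zero])
qed

lemma eventually_Gamma_nonzero: "eventually (\<lambda>s. Gamma ((s + k) / 2) \<noteq> (0::complex)) (at z)"
proof -
  have "(\<lambda>s. rGamma ((s + k) / 2)) meromorphic_on UNIV"
    by (intro analytic_on_imp_meromorphic_on analytic_intros) simp_all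
  from meromorphic_imp_constant_or_avoid[OF this, of 0]
  have "eventually (\<lambda>s. rGamma ((s + k) / 2) = 0) (cosparse UNIV) \<or>
    eventually (\<lambda>s. rGamma ((s + k) / 2) \<noteq> 0) (cosparse UNIV)" by auto
  moreover have "\<not> eventually (\<lambda>s. rGamma ((s + k) / 2) = 0) (cosparse UNIV)"
  proof
    assume "eventually (\<lambda>s. rGamma ((s + k) / 2) = 0) (cosparse UNIV)"
    then have "eventually (\<lambda>s. rGamma ((s + k) / 2) = 0) (at (2 - k))"
      by (rule eventually_cosparse_imp_eventually_at) simp
    moreover have "(\<lambda>s. rGamma ((s + k) / 2)) \<midarrow>2 - k\<rightarrow> rGamma ((2 - k + k) / 2)"
      by (intro isContD analytic_at_imp_isCont analytic_intros) simp_all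
    ultimately have "(\<lambda>s. 0::complex) \<midarrow>2 - k\<rightarrow> rGamma ((2 - k + k) / 2)"
      using Lim_transform_eventually by fast
    then have "rGamma ((2 - k + k) / 2) = 0" by (rule LIM_unique[OF _ tendsto_const])
    then show False by simp
  qed
  ultimately have "eventually (\<lambda>s. rGamma ((s + k) / 2) \<noteq> 0) (cosparse UNIV)" by blast
  then have "eventually (\<lambda>s. rGamma ((s + k) / 2) \<noteq> 0) (at z)"
    by (rule eventually_cosparse_imp_eventually_at) simp
  then show ?thesis by eventually_elim (simp add: rGamma_eq_zero_iff Gamma_eq_zero_iff)
qed

text \<open>
  A pole of a Gamma factor at a point where the \<open>L\<close>-function does not vanish would be a pole of
  the completed \<open>L\<close>-function: dividing by the Gamma factors would give the limit 0.
\<close>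

lemma completed_L_function_no_Gamma_pole:
  fixes f :: "'n::{finite,linorder} aut_form"
  assumes N: "conductor f \<ge> 1" and L: "L_function f analytic_on {s}" "L_function f s \<noteq> 0"
    and \<Lambda>: "completed_L_function \<kappa> f analytic_on {s}" and k: "k \<in># \<kappa>"
  shows "(s + k) / 2 \<notin> \<int>\<^sub>\<le>\<^sub>0"
proof
  assume pole: "(s + k) / 2 \<in> \<int>\<^sub>\<le>\<^sub>0"
  define E where "E = (\<lambda>s. of_nat (conductor f) powr (s / 2) * of_real pi powr (- of_nat CARD('n) * s / 2) * L_function f s)"
  define R where "R = (\<lambda>s::complex. \<Prod>k\<in>#\<kappa>. rGamma ((s + k) / 2))"
  define \<Phi> where "\<Phi> = (\<lambda>s. of_nat (conductor f) powr (s / 2) * of_real pi powr (- of_nat CARD('n) * s / 2) *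
     (\<Prod>k\<in>#\<kappa>. Gamma ((s + k) / 2)) * L_function f s)"
  have E: "E analytic_on {s}"
    unfolding E_def using N by (intro analytic_intros L(1)) (auto simp: iffD2[OF not_le pi_gt_zero])
  have Es: "E s \<noteq> 0" unfolding E_def using N L(2) by simp
  have Gmero: "(\<lambda>s. Gamma ((s + k) / 2)) meromorphic_on {z}" for k z :: complex
  proof -
    have "(\<lambda>s. inverse (rGamma ((s + k) / 2))) meromorphic_on {z}"
      by (intro meromorphic_on_inverse analytic_on_imp_meromorphic_on analytic_intros) simp_all
    then show ?thesis by (simp add: rGamma_inverse_Gamma)
  qed
  have "\<Phi> = (\<lambda>s. E s * (\<Prod>k\<in>#\<kappa>. Gamma ((s + k) / 2)))"
    by (auto simp: \<Phi>_def E_def mult_ac)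
  moreover have "(\<lambda>s. E s * (\<Prod>k\<in>#\<kappa>. Gamma ((s + k) / 2))) meromorphic_on {s}"
    by (intro meromorphic_on_mult meromorphic_on_prod_mset analytic_on_imp_meromorphic_on E Gmero)
  ultimately have "isolated_singularity_at \<Phi> s" by (simp add: meromorphic_at_iff)
  then have ev\<Phi>: "eventually (\<lambda>w. remove_sings \<Phi> w = \<Phi> w) (at s)"
    by (rule eventually_remove_sings_eq_at)
  have \<Lambda>_eq: "completed_L_function \<kappa> f = remove_sings \<Phi>"
    unfolding completed_L_function_def \<Phi>_def ..
  have "R analytic_on {s}" unfolding R_def by (induction \<kappa>) (auto intro!: analytic_intros)
  then have "(\<lambda>w. completed_L_function \<kappa> f w * R w) \<midarrow>s\<rightarrow> completed_L_function \<kappa> f s * R s"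
    using \<Lambda> by (intro isContD analytic_at_imp_isCont analytic_intros)
  moreover have "rGamma ((s + k) / 2) = 0" using pole by (simp add: rGamma_eq_zero_iff)
  then have "R s = 0" unfolding R_def using k by (force simp: prod_mset_zero_iff)
  ultimately have lim0: "(\<lambda>w. completed_L_function \<kappa> f w * R w) \<midarrow>s\<rightarrow> 0" by simp
  have GR: "eventually (\<lambda>w. (\<Prod>k\<in>#\<kappa>. Gamma ((w + k) / 2)) * R w = 1) (at s)"
    unfolding R_def
  proof (induction \<kappa>)
    case (add k \<kappa>)
    from add.IH eventually_Gamma_nonzero[of k s] show ?case
      by eventually_elim (simp add: rGamma_inverse_Gamma field_simps)
  qed simp
  from GR ev\<Phi> have "eventually (\<lambda>w. completed_L_function \<kappa> f w * R w = E w) (at s)"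
  proof eventually_elim
    case (elim w)
    have "completed_L_function \<kappa> f w * R w = E w * ((\<Prod>k\<in>#\<kappa>. Gamma ((w + k) / 2)) * R w)"
      unfolding \<Lambda>_eq elim(2) by (simp add: \<Phi>_def E_def mult_ac)
    then show ?case using elim(1) by simp
  qed
  with lim0 have "E \<midarrow>s\<rightarrow> 0" by (rule Lim_transform_eventually)
  moreover have "E \<midarrow>s\<rightarrow> E s" using E by (intro isContD analytic_at_imp_isCont)
  ultimately show False using Es LIM_unique by blast
qed

lemma completed_L_function_log_deriv:
  fixes f :: "'n::{finite,linorder} aut_form"
  assumes N: "conductor f \<ge> 1" and L: "L_function f analytic_on {s}" "L_function f s \<noteq> 0"
    and \<Lambda>: "completed_L_function \<kappa> f analytic_on {s}"
  shows "deriv (completed_L_function \<kappa> f) s / completed_L_function \<kappa> f s =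
    of_real (ln (real (conductor f))) / 2 + deriv (gamma_factor CARD('n) \<kappa>) s / gamma_factor CARD('n) \<kappa> s +
    deriv (L_function f) s / L_function f s" (is "?lhs = ?rhs")
    and "completed_L_function \<kappa> f s \<noteq> 0"
proof -
  define G where "G = gamma_factor CARD('n) \<kappa>"
  define M where "M = (\<lambda>s. complex_of_nat (conductor f) powr (s / 2))"
  define F where "F = (\<lambda>s. M s * G s * L_function f s)"
  have G: "G analytic_on {s}" "G s \<noteq> 0"
    unfolding G_def using completed_L_function_no_Gamma_pole[OF N L \<Lambda>] by (auto intro!: gamma_factor_analytic)
  have \<Lambda>_eq: "completed_L_function \<kappa> f = remove_sings F"
    unfolding completed_L_function_def F_def G_def M_def gamma_factor_def by (simp add: mult.assoc)
  have M: "M analytic_on {s}" "M s \<noteq> 0" unfolding M_def using N by (auto intro!: analytic_intros)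
  have Fan: "F analytic_on {s}" unfolding F_def by (intro analytic_intros M G L)
  have Fs: "F s \<noteq> 0" using M G L by (simp add: F_def)
  show "completed_L_function \<kappa> f s \<noteq> 0" unfolding \<Lambda>_eq using Fan Fs by simp
  have M': "(M has_field_derivative (M s * (of_real (ln (real (conductor f))) / 2))) (at s)"
  proof -
    have "M = (\<lambda>s. exp (s / 2 * of_real (ln (real (conductor f)))))"
      unfolding M_def powr_def using N by (auto simp: Ln_of_nat)
    moreover have "((\<lambda>s. exp (s / 2 * complex_of_real (ln (real (conductor f))))) has_field_derivative
        exp (s / 2 * of_real (ln (real (conductor f)))) * (of_real (ln (real (conductor f))) / 2)) (at s)"
      by (auto intro!: derivative_eq_intros)
    ultimately show ?thesis by simp
  qed
  have diff: "(h has_field_derivative deriv h s) (at s)" if "h analytic_on {s}" for h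
    using that by (simp add: DERIV_deriv_iff_field_differentiable analytic_on_imp_differentiable_at)
  have "(F has_field_derivative
      (M s * (of_real (ln (real (conductor f))) / 2) * G s + deriv G s * M s) * L_function f s +
      deriv (L_function f) s * (M s * G s)) (at s)"
    unfolding F_def by (intro DERIV_mult M' diff G L)
  then have "deriv F s = (M s * (of_real (ln (real (conductor f))) / 2) * G s + deriv G s * M s) * L_function f s +
      deriv (L_function f) s * (M s * G s)" by (rule DERIV_imp_deriv)
  then have "deriv F s / F s = of_real (ln (real (conductor f))) / 2 + deriv G s / G s +
      deriv (L_function f) s / L_function f s"
    using M(2) G(2) L(2) by (simp add: F_def field_simps)
  then show "?lhs = ?rhs" unfolding \<Lambda>_eq G_def[symmetric] using Fan by simp
qed

lemma E_set_log_deriv_sum: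
  fixes f :: "'n::{finite,linorder} aut_form"
  assumes s: "0 < Re s" "Re s < 1" and N: "N \<ge> 1" and f: "f \<in> E_set \<kappa> N s"
    and L1: "L_function f (1 - s) \<noteq> 0" and FE: "standard_functional_equation \<kappa> f"
  shows "deriv (L_function f) s / L_function f s + deriv (L_function f) (1 - s) / L_function f (1 - s) =
    - (deriv (gamma_factor CARD('n) \<kappa>) s / gamma_factor CARD('n) \<kappa> s +
       deriv (gamma_factor CARD('n) (image_mset cnj \<kappa>)) (1 - s) /
         gamma_factor CARD('n) (image_mset cnj \<kappa>) (1 - s))
    - of_real (ln (real N))"
proof -
  define \<Lambda> where "\<Lambda> = completed_L_function \<kappa> f"
  define M where "M = completed_L_function (image_mset cnj \<kappa>) (dual_form f)"
  have sd: "self_dual f" and cond: "conductor f = N" and L0: "L_function f s \<noteq> 0"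
    using f by (auto simp: E_set_def)
  obtain \<epsilon> where \<epsilon>: "norm \<epsilon> = 1" and eq: "\<And>z. \<Lambda> z = \<epsilon> * M (1 - z)"
    and hol: "\<Lambda> holomorphic_on - {0, 1}" and ex: "\<exists>L. is_L_function f L"
    using FE unfolding standard_functional_equation_def \<Lambda>_def M_def by blast
  have \<epsilon>0: "\<epsilon> \<noteq> 0" using \<epsilon> by auto
  have "is_L_function f (L_function f)" using ex is_L_function_L_function by blast
  then have "L_function f nicely_meromorphic_on UNIV" by (simp add: is_L_function_def)
  then have Lan: "L_function f analytic_on {s}" "L_function f analytic_on {1 - s}"
    using L0 L1 by (simp_all add: nicely_meromorphic_nonzero_imp_analytic)
  have "s \<in> - {0, 1}" using s by auto
  then have \<Lambda>an: "\<Lambda> analytic_on {s}"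
    using hol by (intro holomorphic_on_imp_analytic_at[of _ "- {0, 1}"]) (auto simp: open_Compl)
  have M_eq: "M = (\<lambda>z. \<Lambda> (1 - z) / \<epsilon>)" using eq[of "1 - z" for z] \<epsilon>0 by (simp add: fun_eq_iff)
  have "(\<Lambda> \<circ> (\<lambda>z. 1 - z)) analytic_on {1 - s}"
    using \<Lambda>an by (intro analytic_on_compose analytic_intros) simp
  then have Man: "M analytic_on {1 - s}"
    unfolding M_eq o_def using \<epsilon>0 by (intro analytic_intros) auto
  note ld1 = completed_L_function_log_deriv(1)[of f s \<kappa>, unfolded cond, OF N Lan(1) L0 \<Lambda>an[unfolded \<Lambda>_def]]
  note ld2 = completed_L_function_log_deriv(1)[of "dual_form f" "1 - s" "image_mset cnj \<kappa>",
      unfolded conductor_dual_form[OF sd] L_function_dual_form[OF sd] cond, OF N Lan(2) L1 Man[unfolded M_def]]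
  have "(M has_field_derivative deriv M (1 - s)) (at (1 - s))"
    using Man by (simp add: DERIV_deriv_iff_field_differentiable analytic_on_imp_differentiable_at)
  then have "((\<lambda>z. \<epsilon> * M (1 - z)) has_field_derivative \<epsilon> * (deriv M (1 - s) * - 1)) (at s)"
    by (intro DERIV_cmult DERIV_chain2[where f = M]) (auto intro!: derivative_eq_intros)
  moreover have "\<Lambda> = (\<lambda>z. \<epsilon> * M (1 - z))" using eq by (simp add: fun_eq_iff)
  ultimately have "deriv \<Lambda> s = - (\<epsilon> * deriv M (1 - s))" by (simp add: DERIV_imp_deriv)
  then have "deriv \<Lambda> s / \<Lambda> s = - (deriv M (1 - s) / M (1 - s))"
    using \<epsilon>0 by (simp add: eq)
  then show ?thesis
    unfolding \<Lambda>_def M_def ld1 ld2 by (simp add: algebra_simps eq_neg_iff_add_eq_0)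
qed

theorem theorem4:
  fixes \<kappa> :: "complex multiset" and s\<^sub>0 :: complex and J :: "nat set"
  assumes "size \<kappa> = CARD('n::{finite,linorder})"
    and "0 < Re s\<^sub>0" and "Re s\<^sub>0 < 1"
    and "finite J" and "\<forall>N\<in>J. N \<ge> 1"
    and "\<forall>N\<in>J. (E_set \<kappa> N s\<^sub>0 :: 'n aut_form set) \<noteq> {}"
    and "property_A (int ` J)"
    and "\<forall>N\<in>J. \<forall>f \<in> (E_set \<kappa> N s\<^sub>0 :: 'n aut_form set). L_function f (1 - s\<^sub>0) \<noteq> 0"
    and "\<forall>N\<in>J. \<forall>f \<in> (E_set \<kappa> N s\<^sub>0 :: 'n aut_form set). standard_functional_equation \<kappa> f"
  shows "qbar_dim {deriv (L_function f) s\<^sub>0 / L_function f s\<^sub>0 +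
                   deriv (L_function f) (1 - s\<^sub>0) / L_function f (1 - s\<^sub>0)
                   | (f :: 'n aut_form) N. N \<in> J \<and> f \<in> E_set \<kappa> N s\<^sub>0}
         \<ge> card J - 1"
proof -
  define c where "c = - (deriv (gamma_factor CARD('n) \<kappa>) s\<^sub>0 / gamma_factor CARD('n) \<kappa> s\<^sub>0 +
       deriv (gamma_factor CARD('n) (image_mset cnj \<kappa>)) (1 - s\<^sub>0) /
         gamma_factor CARD('n) (image_mset cnj \<kappa>) (1 - s\<^sub>0))"
  define l where "l = (\<lambda>a::nat. complex_of_real (ln (real a)))"
  define X where "X = {deriv (L_function f) s\<^sub>0 / L_function f s\<^sub>0 +
                   deriv (L_function f) (1 - s\<^sub>0) / L_function f (1 - s\<^sub>0)
                   | (f :: 'n aut_form) N. N \<in> J \<and> f \<in> E_set \<kappa> N s\<^sub>0}"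
  have val: "deriv (L_function f) s\<^sub>0 / L_function f s\<^sub>0 +
      deriv (L_function f) (1 - s\<^sub>0) / L_function f (1 - s\<^sub>0) = c - l N"
    if "N \<in> J" "f \<in> E_set \<kappa> N s\<^sub>0" for N and f :: "'n aut_form"
    using that assms unfolding c_def l_def by (intro E_set_log_deriv_sum) auto
  have "X = (\<lambda>x. c - x) ` l ` J"
  proof (intro equalityI subsetI)
    fix x assume "x \<in> X"
    then show "x \<in> (\<lambda>x. c - x) ` l ` J" unfolding X_def using val by auto
  next
    fix x assume "x \<in> (\<lambda>x. c - x) ` l ` J"
    then obtain N where N: "N \<in> J" "x = c - l N" by auto
    then obtain f :: "'n aut_form" where f: "f \<in> E_set \<kappa> N s\<^sub>0" using assms(6) by blast
    show "x \<in> X" unfolding X_def N(2) using val[OF N(1) f] N(1) f by force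
  qed
  moreover have pos: "a \<ge> 1" if "a \<in> J" for a using assms(5) that by blast
  have indep: "inj_on (\<lambda>e. \<Prod>a\<in>J. a ^ e a) (PiE J (\<lambda>_. UNIV))"
    by (rule property_A_imp_multiplicatively_independent[OF assms(4) pos assms(7)])
  have "card (l ` J) = card J"
    unfolding l_def by (intro card_image qbar_independent_logs(1)[OF assms(4) pos indep])
  moreover have "card (l ` J) - 1 \<le> qbar_dim ((\<lambda>x. c - x) ` l ` J)"
    unfolding l_def using assms(4)
    by (intro qbar_dim_translated qbar_independent_logs(2)[OF assms(4) pos indep]) auto
  ultimately have "card J - 1 \<le> qbar_dim X" by simp
  then show ?thesis unfolding X_def .
qed

end
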